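(* Let $M$ be an orientable Riemannian manifold with Riemannian volume form $\mu_M$, let $\mathcal O$ be a Lie group with Lie algebra $\mathfrak o$, and let $l:\mathfrak X_{\rm vol}(M)\,\circledS\,\mathcal F(M,\mathfrak o)\to\mathbb R$ be a Lagrangian. The Euler-Poincaré equations on the group $\mathcal{A}ut_{\rm vol}(M\times\mathcal O)\simeq\operatorname{Diff}_{\rm vol}(M)\,\circledS\,\mathcal F(M,\mathcal O)$ of volume-preserving automorphisms of the trivial principal bundle $M\times\mathcal O$, for $(\mathbf u,\nu)\in\mathfrak X_{\rm vol}(M)\,\circledS\,\mathcal F(M,\mathfrak o)$, are $$\left\{\begin{array}{l}\displaystyle\frac{\partial}{\partial t}\frac{\delta l}{\delta\mathbf u}+\pounds_{\mathbf u}\frac{\delta l}{\delta\mathbf u}+\frac{\delta l}{\delta\nu}\cdot\mathbf d\nu=-\mathbf dp,\qquad\operatorname{div}(\mathbf u)=0\\[3mm]\displaystyle\frac{\partial}{\partial t}\frac{\delta l}{\delta\nu}+\mathbf d\frac{\delta l}{\delta\nu}\cdot\mathbf u+\operatorname{ad}^*_\nu\frac{\delta l}{\delta\nu}=0,\end{array}\right.$$ where $\pounds_{\mathbf u}$ is the Lie derivative of one-forms and the pressure function $p$ is determined by the incompressibility condition.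
   Context: $\mathcal{A}ut(M\times\mathcal O)$ is the group of diffeomorphisms of $M\times\mathcal O$ commuting with right multiplication of $\mathcal O$ on the second factor; its elements are $(x,g)\mapsto(\eta(x),\chi(x)g)$ with $\eta\in\operatorname{Diff}(M)$, $\chi\in\mathcal F(M,\mathcal O)$ (functions $M\to\mathcal O$). $\mathcal{A}ut_{\rm vol}$ consists of those with $\eta\in\operatorname{Diff}_{\rm vol}(M)$, i.e. $\eta^*\mu_M=\mu_M$. $\mathfrak X_{\rm vol}(M)$ denotes divergence-free vector fields. For a curve $(\eta,\chi)$ the reduced (right-trivialized) variables are $\mathbf u=\dot\eta\circ\eta^{-1}$, $\nu=(\dot\chi\chi^{-1})\circ\eta^{-1}$. The (left) Lie bracket on the Lie algebra $\mathfrak X_{\rm vol}(M)\,\circledS\,\mathcal F(M,\mathfrak o)$ is $[(\mathbf u,\nu),(\mathbf w,\theta)]=(-[\mathbf u,\mathbf w],\ [\nu,\theta]-\mathbf d\theta\cdot\mathbf u+\mathbf d\nu\cdot\mathbf w)$, with $[\mathbf u,\mathbf w]$ the usual (Jacobi-Lie) bracket of vector fields. The regular dual is $(\Omega^1(M)/\mathbf d\mathcal F(M))\times\mathcal F(M,\mathfrak o^* )$ via $\langle([\beta],\sigma),(\mathbf u,\nu)\rangle=\int_M(\beta(\mathbf u)+\sigma\cdot\nu)\,\mu_M$ (nondegenerate $L^2$ duality; regularity is not specified, and integrals and integrations by parts are understood to be valid without boundary terms). Functional derivatives $(\delta l/\delta\mathbf u,\delta l/\delta\nu)$ are defined through this pairing,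 $\delta l/\delta\mathbf u$ being represented by a one-form, defined up to an exact one-form. The Euler-Poincaré equation on a group with right-invariant Lagrangian is $\partial_t\frac{\delta l}{\delta\xi}+\operatorname{ad}^*_\xi\frac{\delta l}{\delta\xi}=0$, where $\operatorname{ad}^*_\xi$ is the transpose of $\operatorname{ad}_\xi=[\xi,\cdot]$. In the claim, the first equation is written on $\Omega^1(M)$ rather than on the quotient, and $\operatorname{ad}^*_\nu$ is the pointwise operator $\langle\operatorname{ad}^*_\xi\mu,\eta\rangle=\langle\mu,[\xi,\eta]\rangle$ on $\mathfrak o^*$. *)

theory Defs
  imports "HOL-Analysis.Analysis" "HOL-Library.Function_Algebras"
begin

section \<open>Smooth manifolds\<close>

primrec Ck_on :: "nat \<Rightarrow> ('a::real_normed_vector \<Rightarrow> 'b::real_normed_vector) \<Rightarrow> 'a set \<Rightarrow> bool" where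
  "Ck_on 0 f S \<longleftrightarrow> continuous_on S f"
| "Ck_on (Suc k) f S \<longleftrightarrow>
     f differentiable_on S \<and> (\<forall>v. Ck_on k (\<lambda>x. frechet_derivative f (at x) v) S)"

definition smooth_on :: "'a::real_normed_vector set \<Rightarrow> ('a \<Rightarrow> 'b::real_normed_vector) \<Rightarrow> bool" where
  "smooth_on S f \<longleftrightarrow> (\<forall>k. Ck_on k f S)"

text \<open>A manifold is a whole type, with a smooth structure given by a set of charts \<open>(U, \<phi>)\<close>; the
  inverse of a chart is \<open>inv_into U \<phi>\<close>. Its dimension is that of the model space.\<close>

type_synonym ('m, 'e) atlas = "('m set \<times> ('m \<Rightarrow> 'e)) set"

definition smooth_atlas ::
    "('m::{second_countable_topology,t2_space}, 'e::euclidean_space) atlas \<Rightarrow> bool" where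
  "smooth_atlas M \<longleftrightarrow>
     (\<Union>(U, \<phi>)\<in>M. U) = UNIV \<and>
     (\<forall>(U, \<phi>)\<in>M. open U \<and> open (\<phi> ` U) \<and> homeomorphism U (\<phi> ` U) \<phi> (inv_into U \<phi>)) \<and>
     (\<forall>(U, \<phi>)\<in>M. \<forall>(V, \<psi>)\<in>M. smooth_on (\<phi> ` (U \<inter> V)) (\<psi> \<circ> inv_into U \<phi>))"

definition prod_atlas :: "('m, 'e) atlas \<Rightarrow> ('n, 'f) atlas \<Rightarrow> ('m \<times> 'n, 'e \<times> 'f) atlas" where
  "prod_atlas M N = {(U \<times> V, map_prod \<phi> \<psi>) | U \<phi> V \<psi>. (U, \<phi>) \<in> M \<and> (V, \<psi>) \<in> N}"

definition smooth_map :: "('m::topological_space, 'e::real_normed_vector) atlas \<Rightarrow>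
    ('n::topological_space, 'f::real_normed_vector) atlas \<Rightarrow> ('m \<Rightarrow> 'n) \<Rightarrow> bool" where
  "smooth_map M N f \<longleftrightarrow> continuous_on UNIV f \<and>
     (\<forall>(U, \<phi>)\<in>M. \<forall>(V, \<psi>)\<in>N. smooth_on (\<phi> ` (U \<inter> f -` V)) (\<psi> \<circ> f \<circ> inv_into U \<phi>))"

definition smooth_fun :: "('m, 'e::real_normed_vector) atlas \<Rightarrow> ('m \<Rightarrow> real) set" where
  "smooth_fun M = {f. \<forall>(U, \<phi>)\<in>M. smooth_on (\<phi> ` U) (f \<circ> inv_into U \<phi>)}"


section \<open>Vector fields, one-forms, volume forms\<close>

text \<open>Tangent vectors at \<open>x\<close> are derivations at \<open>x\<close> of the algebra of smooth functions. They are
  extended by \<open>0\<close> to non-smooth functions, and covectors are extended by \<open>0\<close> to arguments that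
  are not tangent vectors, so that equality of fields is equality of HOL functions. Sums and
  products of functions are pointwise (\<open>Function_Algebras\<close>).\<close>

type_synonym 'm tangent = "('m \<Rightarrow> real) \<Rightarrow> real"
type_synonym 'm vector_field = "'m \<Rightarrow> 'm tangent"
type_synonym 'm one_form = "'m \<Rightarrow> 'm tangent \<Rightarrow> real"

definition tangent_space :: "('m, 'e::real_normed_vector) atlas \<Rightarrow> 'm \<Rightarrow> 'm tangent set" where
  "tangent_space M x = {v.
     (\<forall>f\<in>smooth_fun M. \<forall>g\<in>smooth_fun M.
        v (f + g) = v f + v g \<and> v (f * g) = v f * g x + f x * v g) \<and>
     (\<forall>f\<in>smooth_fun M. \<forall>c. v (\<lambda>y. c * f y) = c * v f) \<and>
     (\<forall>f. f \<notin> smooth_fun M \<longrightarrow> v f = 0)}"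

definition vector_fields :: "('m, 'e::real_normed_vector) atlas \<Rightarrow> 'm vector_field set" where
  "vector_fields M = {u. (\<forall>x. u x \<in> tangent_space M x) \<and>
     (\<forall>f\<in>smooth_fun M. (\<lambda>x. u x f) \<in> smooth_fun M)}"

definition jacobi_lie :: "'m vector_field \<Rightarrow> 'm vector_field \<Rightarrow> 'm vector_field" where
  "jacobi_lie u w = (\<lambda>x f. u x (\<lambda>y. w y f) - w x (\<lambda>y. u y f))"

definition linear_on :: "('a \<Rightarrow> real) set \<Rightarrow> (('a \<Rightarrow> real) \<Rightarrow> real) \<Rightarrow> bool" where
  "linear_on V \<alpha> \<longleftrightarrow> (\<forall>v\<in>V. \<forall>w\<in>V. \<alpha> (v + w) = \<alpha> v + \<alpha> w) \<and>
     (\<forall>v\<in>V. \<forall>c. \<alpha> (\<lambda>a. c * v a) = c * \<alpha> v)"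

definition dual_space :: "('a \<Rightarrow> real) set \<Rightarrow> (('a \<Rightarrow> real) \<Rightarrow> real) set" where
  "dual_space V = {\<alpha>. linear_on V \<alpha> \<and> (\<forall>v. v \<notin> V \<longrightarrow> \<alpha> v = 0)}"

definition one_forms :: "('m, 'e::real_normed_vector) atlas \<Rightarrow> 'm one_form set" where
  "one_forms M = {\<beta>. (\<forall>x. \<beta> x \<in> dual_space (tangent_space M x)) \<and>
     (\<forall>u\<in>vector_fields M. (\<lambda>x. \<beta> x (u x)) \<in> smooth_fun M)}"

definition ext_d :: "('m, 'e::real_normed_vector) atlas \<Rightarrow> ('m \<Rightarrow> real) \<Rightarrow> 'm one_form" where
  "ext_d M f = (\<lambda>x v. if v \<in> tangent_space M x then v f else 0)"

text \<open>\<open>\<pounds>\<^sub>u \<beta>\<close> is the one-form for which \<open>u[\<beta>(w)] = (\<pounds>\<^sub>u \<beta>)(w) + \<beta>([u,w])\<close>.\<close>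

definition lie_derivative ::
    "('m, 'e::real_normed_vector) atlas \<Rightarrow> 'm vector_field \<Rightarrow> 'm one_form \<Rightarrow> 'm one_form" where
  "lie_derivative M u \<beta> = (THE \<gamma>. \<gamma> \<in> one_forms M \<and>
     (\<forall>w\<in>vector_fields M. \<forall>x. \<gamma> x (w x) = u x (\<lambda>y. \<beta> y (w y)) - \<beta> x (jacobi_lie u w x)))"

definition riemannian_metric :: "('m, 'e::real_normed_vector) atlas \<Rightarrow>
    ('m \<Rightarrow> 'm tangent \<Rightarrow> 'm tangent \<Rightarrow> real) \<Rightarrow> bool" where
  "riemannian_metric M g \<longleftrightarrow>
     (\<forall>x. \<forall>v\<in>tangent_space M x. linear_on (tangent_space M x) (g x v) \<and>
        (\<forall>w\<in>tangent_space M x. g x v w = g x w v) \<and> (v \<noteq> 0 \<longrightarrow> g x v v > 0)) \<and>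
     (\<forall>u\<in>vector_fields M. \<forall>w\<in>vector_fields M. (\<lambda>x. g x (u x) (w x)) \<in> smooth_fun M)"

text \<open>Differential forms of top degree. Their arguments are families of tangent vectors indexed by
  the canonical basis of the model space.\<close>

definition top_form :: "('m, 'e::euclidean_space) atlas \<Rightarrow>
    ('m \<Rightarrow> ('e \<Rightarrow> 'm tangent) \<Rightarrow> real) \<Rightarrow> bool" where
  "top_form M \<mu> \<longleftrightarrow>
     (\<forall>x E E'. (\<forall>b\<in>Basis. E b = E' b) \<longrightarrow> \<mu> x E = \<mu> x E') \<and>
     (\<forall>x E. (\<forall>b\<in>Basis. E b \<in> tangent_space M x) \<longrightarrow>
        (\<forall>b\<in>Basis. linear_on (tangent_space M x) (\<lambda>v. \<mu> x (E(b := v)))) \<and>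
        (\<forall>b\<in>Basis. \<forall>c\<in>Basis. b \<noteq> c \<and> E b = E c \<longrightarrow> \<mu> x E = 0)) \<and>
     (\<forall>W. (\<forall>b\<in>Basis. W b \<in> vector_fields M) \<longrightarrow> (\<lambda>x. \<mu> x (\<lambda>b. W b x)) \<in> smooth_fun M)"

text \<open>A smooth top form of absolute value \<open>1\<close> on orthonormal frames vanishes nowhere: its existence
  expresses that \<open>M\<close> is orientable, and its choice orients \<open>M\<close> (positive frames being those on
  which it is positive).\<close>

definition riemannian_volume_form :: "('m, 'e::euclidean_space) atlas \<Rightarrow>
    ('m \<Rightarrow> 'm tangent \<Rightarrow> 'm tangent \<Rightarrow> real) \<Rightarrow> ('m \<Rightarrow> ('e \<Rightarrow> 'm tangent) \<Rightarrow> real) \<Rightarrow> bool" where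
  "riemannian_volume_form M g \<mu> \<longleftrightarrow> top_form M \<mu> \<and>
     (\<forall>x E. (\<forall>b\<in>Basis. E b \<in> tangent_space M x) \<and>
        (\<forall>b\<in>Basis. \<forall>c\<in>Basis. g x (E b) (E c) = (if b = c then 1 else 0)) \<longrightarrow> \<bar>\<mu> x E\<bar> = 1)"

definition coord_vector ::
    "('m, 'e::euclidean_space) atlas \<Rightarrow> 'm set \<Rightarrow> ('m \<Rightarrow> 'e) \<Rightarrow> 'm \<Rightarrow> 'e \<Rightarrow> 'm tangent" where
  "coord_vector M U \<phi> x b = (\<lambda>f. if f \<in> smooth_fun M
     then frechet_derivative (f \<circ> inv_into U \<phi>) (at (\<phi> x)) b else 0)"

text \<open>The measure \<open>m\<close> for which \<open>\<integral> f dm\<close> is the integral of the form \<open>f \<mu>\<close> over \<open>M\<close>, oriented by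
  \<open>\<mu>\<close>: in a chart its density is \<open>\<bar>\<mu>(\<partial>\<^sub>1, \<dots>, \<partial>\<^sub>n)\<bar>\<close>.\<close>

definition volume_measure :: "('m::topological_space, 'e::euclidean_space) atlas \<Rightarrow>
    ('m \<Rightarrow> ('e \<Rightarrow> 'm tangent) \<Rightarrow> real) \<Rightarrow> 'm measure \<Rightarrow> bool" where
  "volume_measure M \<mu> m \<longleftrightarrow> sets m = sets borel \<and>
     (\<forall>(U, \<phi>)\<in>M. \<forall>S\<in>sets borel. S \<subseteq> U \<longrightarrow>
        emeasure m S = (\<integral>\<^sup>+y\<in>\<phi> ` S. ennreal \<bar>\<mu> (inv_into U \<phi> y)
          (coord_vector M U \<phi> (inv_into U \<phi> y))\<bar> \<partial>lborel))"

text \<open>\<open>div u = h\<close>, i.e. \<open>\<pounds>\<^sub>u \<mu> = h \<mu>\<close>, both sides being evaluated on vector fields \<open>W\<^sub>1, \<dots>, W\<^sub>n\<close>.\<close>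

definition has_divergence :: "('m, 'e::euclidean_space) atlas \<Rightarrow>
    ('m \<Rightarrow> ('e \<Rightarrow> 'm tangent) \<Rightarrow> real) \<Rightarrow> 'm vector_field \<Rightarrow> ('m \<Rightarrow> real) \<Rightarrow> bool" where
  "has_divergence M \<mu> u h \<longleftrightarrow> (\<forall>W. (\<forall>b\<in>Basis. W b \<in> vector_fields M) \<longrightarrow>
     (\<forall>x. u x (\<lambda>y. \<mu> y (\<lambda>b. W b y))
            - (\<Sum>b\<in>Basis. \<mu> x ((\<lambda>c. W c x)(b := jacobi_lie u (W b) x)))
          = h x * \<mu> x (\<lambda>b. W b x)))"

definition div_free_fields :: "('m, 'e::euclidean_space) atlas \<Rightarrow>
    ('m \<Rightarrow> ('e \<Rightarrow> 'm tangent) \<Rightarrow> real) \<Rightarrow> 'm vector_field set" where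
  "div_free_fields M \<mu> = {u\<in>vector_fields M. has_divergence M \<mu> u (\<lambda>x. 0)}"


section \<open>Lie groups\<close>

definition lie_group :: "('g::{second_countable_topology,t2_space}, 'f::euclidean_space) atlas \<Rightarrow>
    ('g \<Rightarrow> 'g \<Rightarrow> 'g) \<Rightarrow> 'g \<Rightarrow> ('g \<Rightarrow> 'g) \<Rightarrow> bool" where
  "lie_group G mul e inve \<longleftrightarrow> smooth_atlas G \<and> group mul e inve \<and>
     smooth_map (prod_atlas G G) G (\<lambda>(g, h). mul g h) \<and> smooth_map G G inve"

text \<open>The Lie algebra of \<open>\<O>\<close> is \<open>tangent_space G e\<close>, with the bracket of left-invariant vector
  fields.\<close>

definition left_invariant :: "('g, 'f::real_normed_vector) atlas \<Rightarrow> ('g \<Rightarrow> 'g \<Rightarrow> 'g) \<Rightarrow>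
    'g tangent \<Rightarrow> 'g vector_field" where
  "left_invariant G mul \<xi> = (\<lambda>g f. if f \<in> smooth_fun G then \<xi> (\<lambda>h. f (mul g h)) else 0)"

definition lie_bracket :: "('g, 'f::real_normed_vector) atlas \<Rightarrow> ('g \<Rightarrow> 'g \<Rightarrow> 'g) \<Rightarrow> 'g \<Rightarrow>
    'g tangent \<Rightarrow> 'g tangent \<Rightarrow> 'g tangent" where
  "lie_bracket G mul e \<xi> \<eta> = jacobi_lie (left_invariant G mul \<xi>) (left_invariant G mul \<eta>) e"

text \<open>Smoothness of a map into the finite-dimensional space \<open>\<o> = T\<^sub>e\<O>\<close> is smoothness of its
  composites with the elements of \<open>\<o>\<^sup>*\<close>; these are the functionals \<open>\<xi> \<mapsto> \<xi>[f]\<close>.\<close>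

definition algebra_valued :: "('m, 'e::real_normed_vector) atlas \<Rightarrow>
    ('g, 'f::real_normed_vector) atlas \<Rightarrow> 'g \<Rightarrow> ('m \<Rightarrow> 'g tangent) set" where
  "algebra_valued M G e = {\<nu>. (\<forall>x. \<nu> x \<in> tangent_space G e) \<and>
     (\<forall>f\<in>smooth_fun G. (\<lambda>x. \<nu> x f) \<in> smooth_fun M)}"

definition coalgebra_valued :: "('m, 'e::real_normed_vector) atlas \<Rightarrow>
    ('g, 'f::real_normed_vector) atlas \<Rightarrow> 'g \<Rightarrow> ('m \<Rightarrow> 'g tangent \<Rightarrow> real) set" where
  "coalgebra_valued M G e = {\<sigma>. (\<forall>x. \<sigma> x \<in> dual_space (tangent_space G e)) \<and>
     (\<forall>\<xi>\<in>tangent_space G e. (\<lambda>x. \<sigma> x \<xi>) \<in> smooth_fun M)}"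

text \<open>The differential \<open>d\<kappa>\<^sub>x \<cdot> v\<close> of a map \<open>\<kappa>\<close> into \<open>\<o>\<close> or \<open>\<o>\<^sup>*\<close>, both of which are spaces of
  real-valued functions.\<close>

definition diff_along :: "('m \<Rightarrow> 'a \<Rightarrow> real) \<Rightarrow> 'm tangent \<Rightarrow> 'a \<Rightarrow> real" where
  "diff_along \<kappa> v = (\<lambda>a. v (\<lambda>y. \<kappa> y a))"

definition ad_star :: "('g, 'f::real_normed_vector) atlas \<Rightarrow> ('g \<Rightarrow> 'g \<Rightarrow> 'g) \<Rightarrow> 'g \<Rightarrow>
    'g tangent \<Rightarrow> ('g tangent \<Rightarrow> real) \<Rightarrow> 'g tangent \<Rightarrow> real" where
  "ad_star G mul e \<xi> \<alpha> =
     (\<lambda>\<eta>. if \<eta> \<in> tangent_space G e then \<alpha> (lie_bracket G mul e \<xi> \<eta>) else 0)"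

text \<open>The one-form \<open>\<sigma> \<cdot> d\<nu>\<close>.\<close>

definition contract_d :: "('m, 'e::real_normed_vector) atlas \<Rightarrow> ('m \<Rightarrow> 'g tangent \<Rightarrow> real) \<Rightarrow>
    ('m \<Rightarrow> 'g tangent) \<Rightarrow> 'm one_form" where
  "contract_d M \<sigma> \<nu> = (\<lambda>x v. if v \<in> tangent_space M x then \<sigma> x (diff_along \<nu> v) else 0)"


section \<open>Euler-Poincare equations\<close>

text \<open>For a Lie algebra \<open>L\<close> with bracket \<open>br\<close> and a pairing of a space \<open>D\<close> with \<open>L\<close> whose
  null space in \<open>D\<close> is \<open>Z\<close>, the regular dual is \<open>D/Z\<close>, and its elements are given by
  representatives. The transpose \<open>ad\<^sup>*\<^sub>\<xi> \<alpha>\<close> is determined up to \<open>Z\<close>.\<close>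

definition coadjoint :: "'l set \<Rightarrow> 'd set \<Rightarrow> ('d \<Rightarrow> 'l \<Rightarrow> real) \<Rightarrow> ('l \<Rightarrow> 'l \<Rightarrow> 'l) \<Rightarrow>
    'l \<Rightarrow> 'd \<Rightarrow> 'd" where
  "coadjoint L D pair br \<xi> \<alpha> =
     (SOME \<tau>. \<tau> \<in> D \<and> (\<forall>\<zeta>\<in>L. pair \<tau> \<zeta> = pair \<alpha> (br \<xi> \<zeta>)))"

definition euler_poincare :: "'l set \<Rightarrow> 'd::plus set \<Rightarrow> 'd set \<Rightarrow> ('d \<Rightarrow> 'l \<Rightarrow> real) \<Rightarrow>
    ('l \<Rightarrow> 'l \<Rightarrow> 'l) \<Rightarrow> 'l \<Rightarrow> 'd \<Rightarrow> 'd \<Rightarrow> bool" where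
  "euler_poincare L D Z pair br \<xi> \<alpha> \<alpha>\<^sub>t \<longleftrightarrow> \<alpha>\<^sub>t + coadjoint L D pair br \<xi> \<alpha> \<in> Z"

text \<open>The left Lie bracket on the Lie algebra of the group of maps \<open>(x, g) \<mapsto> (\<eta>(x), \<chi>(x) g)\<close> of
  \<open>M \<times> \<O>\<close>, in the right-trivialized variables \<open>u = \<eta>' \<circ> \<eta>\<^sup>-\<^sup>1\<close>, \<open>\<nu> = (\<chi>' \<chi>\<^sup>-\<^sup>1) \<circ> \<eta>\<^sup>-\<^sup>1\<close>. Its first
  component is minus the Jacobi-Lie bracket.\<close>

definition aut_bracket :: "('g, 'f::real_normed_vector) atlas \<Rightarrow> ('g \<Rightarrow> 'g \<Rightarrow> 'g) \<Rightarrow> 'g \<Rightarrow>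
    'm vector_field \<times> ('m \<Rightarrow> 'g tangent) \<Rightarrow> 'm vector_field \<times> ('m \<Rightarrow> 'g tangent) \<Rightarrow>
    'm vector_field \<times> ('m \<Rightarrow> 'g tangent)" where
  "aut_bracket G mul e = (\<lambda>(u, \<nu>) (w, \<theta>). (- jacobi_lie u w,
     \<lambda>x. lie_bracket G mul e (\<nu> x) (\<theta> x) - diff_along \<theta> (u x) + diff_along \<nu> (w x)))"

definition l2_pairing :: "'m measure \<Rightarrow> 'm one_form \<times> ('m \<Rightarrow> 'g tangent \<Rightarrow> real) \<Rightarrow>
    'm vector_field \<times> ('m \<Rightarrow> 'g tangent) \<Rightarrow> real" where
  "l2_pairing m = (\<lambda>(\<beta>, \<sigma>) (u, \<nu>). \<integral>x. \<beta> x (u x) + \<sigma> x (\<nu> x) \<partial>m)"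

definition functional_derivative :: "'m measure \<Rightarrow>
    ('m vector_field \<times> ('m \<Rightarrow> 'g tangent)) set \<Rightarrow>
    ('m one_form \<times> ('m \<Rightarrow> 'g tangent \<Rightarrow> real)) set \<Rightarrow>
    ('m vector_field \<times> ('m \<Rightarrow> 'g tangent) \<Rightarrow> real) \<Rightarrow>
    'm vector_field \<times> ('m \<Rightarrow> 'g tangent) \<Rightarrow>
    'm one_form \<times> ('m \<Rightarrow> 'g tangent \<Rightarrow> real) \<Rightarrow> bool" where
  "functional_derivative m L D l = (\<lambda>(u, \<nu>) \<alpha>. \<alpha> \<in> D \<and>
     (\<forall>(w, \<theta>)\<in>L. ((\<lambda>\<epsilon>. l (\<lambda>x f. u x f + \<epsilon> * w x f, \<lambda>x f. \<nu> x f + \<epsilon> * \<theta> x f))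
        has_real_derivative l2_pairing m \<alpha> (w, \<theta>)) (at 0)))"

text \<open>The sections \<open>X\<close>, \<open>N\<close>, \<open>B\<close>, \<open>S\<close>, \<open>F\<close> of class \<open>C\<^sup>\<infinity>\<close> play the roles of divergence-free vector
  fields, \<open>\<o>\<close>-valued functions, one-forms, \<open>\<o>\<^sup>*\<close>-valued functions and real functions. When \<open>M\<close> is
  compact, they may be all smooth sections. In general they are the sections in a function class
  for which \<open>L\<^sup>2\<close> duality and integration by parts make sense, e.g. compactly supported ones for
  \<open>X\<close> and \<open>N\<close> and arbitrary smooth ones for \<open>B\<close>, \<open>S\<close> and \<open>F\<close>.\<close>

locale l2_duality =
  fixes M :: "('m::{second_countable_topology,t2_space}, 'e::euclidean_space) atlas"
    and \<mu> :: "'m \<Rightarrow> ('e \<Rightarrow> 'm tangent) \<Rightarrow> real"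
    and m :: "'m measure"
    and G :: "('g::{second_countable_topology,t2_space}, 'f::euclidean_space) atlas"
    and mul :: "'g \<Rightarrow> 'g \<Rightarrow> 'g"
    and e :: 'g
    and X :: "'m vector_field set"
    and N :: "('m \<Rightarrow> 'g tangent) set"
    and B :: "'m one_form set"
    and S :: "('m \<Rightarrow> 'g tangent \<Rightarrow> real) set"
    and F :: "('m \<Rightarrow> real) set"
  assumes smooth:
      "X \<subseteq> div_free_fields M \<mu>" "N \<subseteq> algebra_valued M G e"
      "B \<subseteq> one_forms M" "S \<subseteq> coalgebra_valued M G e" "F \<subseteq> smooth_fun M"
    and subspaces:
      "module.subspace (\<lambda>c u x a. c * u x a) X" "module.subspace (\<lambda>c u x a. c * u x a) N"
      "module.subspace (\<lambda>c u x a. c * u x a) B" "module.subspace (\<lambda>c u x a. c * u x a) S"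
      "module.subspace (\<lambda>c f x. c * f x) F"
    and lie_algebra:
      "\<lbrakk>\<xi> \<in> X \<times> N; \<zeta> \<in> X \<times> N\<rbrakk> \<Longrightarrow> aut_bracket G mul e \<xi> \<zeta> \<in> X \<times> N"
    and operations:
      "f \<in> F \<Longrightarrow> ext_d M f \<in> B"
      "\<lbrakk>\<beta> \<in> B; u \<in> X\<rbrakk> \<Longrightarrow> (\<lambda>x. \<beta> x (u x)) \<in> F"
      "\<lbrakk>\<sigma> \<in> S; \<nu> \<in> N\<rbrakk> \<Longrightarrow> (\<lambda>x. \<sigma> x (\<nu> x)) \<in> F"
      "\<lbrakk>\<beta> \<in> B; u \<in> X\<rbrakk> \<Longrightarrow> lie_derivative M u \<beta> \<in> B"
      "\<lbrakk>\<sigma> \<in> S; \<nu> \<in> N\<rbrakk> \<Longrightarrow> contract_d M \<sigma> \<nu> \<in> B"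
      "\<lbrakk>\<sigma> \<in> S; u \<in> X\<rbrakk> \<Longrightarrow> (\<lambda>x. diff_along \<sigma> (u x)) \<in> S"
      "\<lbrakk>\<sigma> \<in> S; \<nu> \<in> N\<rbrakk> \<Longrightarrow> (\<lambda>x. ad_star G mul e (\<nu> x) (\<sigma> x)) \<in> S"
    and integrable:
      "\<lbrakk>\<beta> \<in> B; u \<in> X\<rbrakk> \<Longrightarrow> integrable m (\<lambda>x. \<beta> x (u x))"
      "\<lbrakk>\<sigma> \<in> S; \<nu> \<in> N\<rbrakk> \<Longrightarrow> integrable m (\<lambda>x. \<sigma> x (\<nu> x))"
    and no_boundary_terms:
      "\<lbrakk>f \<in> F; u \<in> X; has_divergence M \<mu> (\<lambda>x a. f x * u x a) h\<rbrakk> \<Longrightarrow> (\<integral>x. h x \<partial>m) = 0"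
    and nondegenerate:
      "\<lbrakk>\<alpha> \<in> B \<times> S; \<And>\<zeta>. \<zeta> \<in> X \<times> N \<Longrightarrow> l2_pairing m \<alpha> \<zeta> = 0\<rbrakk> \<Longrightarrow> \<alpha> \<in> (ext_d M ` F) \<times> {0}"

text \<open>In this setting the Lie algebra is \<open>X \<times> N\<close>, and its regular dual is the quotient of \<open>B \<times> S\<close>
  by \<open>dF \<times> {0}\<close>.\<close>

definition euler_poincare_aut_vol where
  "euler_poincare_aut_vol M m G mul e X N B S F =
     euler_poincare (X \<times> N) (B \<times> S) ((ext_d M ` F) \<times> {0}) (l2_pairing m) (aut_bracket G mul e)"

definition time_deriv :: "(real \<Rightarrow> 'm \<Rightarrow> 'a \<Rightarrow> real) \<Rightarrow> real \<Rightarrow> 'm \<Rightarrow> 'a \<Rightarrow> real" where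
  "time_deriv \<kappa> t = (\<lambda>x a. deriv (\<lambda>s. \<kappa> s x a) t)"

end

theory Submission
  imports Defs
begin

text \<open>Evaluated on \<open>(w, \<theta>)\<close>, the one-form and the \<open>\<o>\<^sup>*\<close>-valued function
  \<open>(\<pounds>\<^sub>u \<beta> + \<sigma> \<cdot> d\<nu>, d\<sigma> \<cdot> u + ad\<^sup>*\<^sub>\<nu> \<sigma>)\<close> and the functional \<open>(\<beta>, \<sigma>) \<circ> ad\<^bsub>(u, \<nu>)\<^esub>\<close> differ by
  the integral of \<open>u[\<beta>(w) + \<sigma>(\<theta>)]\<close>. This integral vanishes since \<open>u[f] = div (f u)\<close> for
  divergence-free \<open>u\<close>. Hence the former represents \<open>ad\<^sup>*\<^bsub>(u, \<nu>)\<^esub> (\<beta>, \<sigma>)\<close> in the regular dual, whose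
  zero class consists of the \<open>(dp, 0)\<close>.

  As tangent vectors are derivations, the product rules for \<open>\<pounds>\<^sub>u \<beta>\<close>, \<open>d\<sigma> \<cdot> u\<close> and \<open>div (f u)\<close> depend
  on the fact that the tangent space is spanned by the \<open>n\<close> coordinate vectors, which comes from
  bump functions and Hadamard's lemma.\<close>

section \<open>Calculus of smooth functions\<close>

text \<open>Three features of the definitions shape the proof. The coadjoint operator is a
  \<open>SOME\<close> representative and the Lie derivative a \<open>THE\<close> description, so
  nothing is known about either before a witness is exhibited. For the Lie derivative the witness
  comes from tensoriality of the defining formula. For the coadjoint operator it is the explicit
  pair; the chosen representative may differ from it, but by nondegeneracy only by a member of
  \<open>dF \<times> {0}\<close>, and this exact form is absorbed into the pressure gradient.

  Tangent vectors act only on globally defined smooth functions, so every local argument is made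
  with cut-off functions instead of germs or coordinate functions.

  Fields are compared as HOL functions, so identities between them must also be checked at
  non-smooth arguments, where the values are 0.

  Time enters only through the given derivatives of the momenta: the equivalence is proved at each
  fixed time.\<close>

text \<open>On an open set the derivative at a point depends only on values inside the set, so
  agreement on \<open>S\<close> passes through the recursion on \<open>k\<close>.\<close>

lemma Ck_on_cong:
  assumes "open S" "Ck_on k f S" "\<And>x. x \<in> S \<Longrightarrow> f x = g x"
  shows "Ck_on k g S"
  using assms(2,3)
proof (induction k arbitrary: f g)
  case 0
  then show ?case using continuous_on_cong[of S S f g] by simp
next
  case (Suc k)
  have g: "(g has_derivative frechet_derivative f (at x)) (at x)" if "x \<in> S" for x
  proof (rule has_derivative_transform_within_open[OF _ assms(1) that])
    show "(f has_derivative frechet_derivative f (at x)) (at x)"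
      using Suc.prems(1) that assms(1)
      by (auto simp: differentiable_on_eq_differentiable_at frechet_derivative_works)
  qed (use Suc.prems in auto)
  then have "g differentiable_on S"
    by (meson differentiable_at_imp_differentiable_on differentiable_def)
  moreover have "Ck_on k (\<lambda>x. frechet_derivative g (at x) v) S" for v
  proof (rule Suc.IH)
    show "Ck_on k (\<lambda>x. frechet_derivative f (at x) v) S"
      using Suc.prems(1) by simp
    show "frechet_derivative f (at x) v = frechet_derivative g (at x) v" if "x \<in> S" for x
      using frechet_derivative_at[OF g[OF that]] by simp
  qed
  ultimately show ?case by simp
qed

text \<open>Lets the induction steps below use a derivative given by a formula \<open>f'\<close>;
  uniqueness of derivatives at interior points identifies it with
  \<open>frechet_derivative\<close>.\<close>

lemma Ck_on_SucI:
  assumes "open S" "\<And>x. x \<in> S \<Longrightarrow> (f has_derivative f' x) (at x)"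
    and "\<And>v. Ck_on k (\<lambda>x. f' x v) S"
  shows "Ck_on (Suc k) f S"
proof -
  have "f differentiable_on S"
    using assms(2) by (meson differentiable_at_imp_differentiable_on differentiable_def)
  moreover have "Ck_on k (\<lambda>x. frechet_derivative f (at x) v) S" for v
  proof (rule Ck_on_cong[OF assms(1) assms(3)[of v]])
    show "f' x v = frechet_derivative f (at x) v" if "x \<in> S" for x
      using frechet_derivative_at[OF assms(2)[OF that]] by simp
  qed
  ultimately show ?thesis by simp
qed

lemma Ck_on_Suc_has_derivative:
  assumes "open S" "Ck_on (Suc k) f S" "x \<in> S"
  shows "(f has_derivative frechet_derivative f (at x)) (at x)"
  using assms by (auto simp: differentiable_on_eq_differentiable_at frechet_derivative_works)

lemma Ck_on_SucD:
  assumes "open S" "Ck_on (Suc k) f S"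
  shows "Ck_on k f S"
  using assms(2)
proof (induction k arbitrary: f)
  case 0
  then show ?case by (simp add: differentiable_imp_continuous_on)
next
  case (Suc k)
  then show ?case by (metis Ck_on.simps(2))
qed

lemma Ck_on_Un:
  assumes "open S" "open T" "Ck_on k f S" "Ck_on k f T"
  shows "Ck_on k f (S \<union> T)"
  using assms(3,4)
proof (induction k arbitrary: f)
  case 0
  then show ?case using assms by (simp add: continuous_on_open_Un)
next
  case (Suc k)
  then have "f differentiable_on S \<union> T"
    using assms(1,2) by (auto simp: differentiable_on_eq_differentiable_at open_Un)
  with Suc show ?case by simp
qed

lemma Ck_on_subset:
  assumes "open S" "open T" "T \<subseteq> S" "Ck_on k f S"
  shows "Ck_on k f T"
  using assms(4)
  by (induction k arbitrary: f)
    (use assms(3) in \<open>auto intro: continuous_on_subset differentiable_on_subset\<close>)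

lemma Ck_on_const: "open S \<Longrightarrow> Ck_on k (\<lambda>x. c) S"
proof (induction k arbitrary: c)
  case (Suc k)
  then show ?case by (intro Ck_on_SucI[where f' = "\<lambda>x v. 0"]) auto
qed auto

lemma Ck_on_bounded_linear:
  assumes "bounded_linear L" "open S" "Ck_on k f S"
  shows "Ck_on k (\<lambda>x. L (f x)) S"
  using assms(3)
proof (induction k arbitrary: f)
  case 0
  then show ?case
    using assms(1) by (auto intro: bounded_linear.continuous_on)
next
  case (Suc k)
  show ?case
    by (intro Ck_on_SucI[where f' = "\<lambda>x v. L (frechet_derivative f (at x) v)"] assms(2)
        bounded_linear.has_derivative[OF assms(1)] Ck_on_Suc_has_derivative[OF assms(2) Suc.prems]
        Suc.IH) (use Suc.prems in auto)
qed

lemma Ck_on_id: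
  assumes "open S"
  shows "Ck_on k (\<lambda>x. x) S"
proof (cases k)
  case (Suc n)
  then show ?thesis
    using assms by (auto intro!: Ck_on_SucI[where f' = "\<lambda>x v. v"] Ck_on_const)
qed auto

lemma Ck_on_add:
  assumes "open S" "Ck_on k f S" "Ck_on k g S"
  shows "Ck_on k (\<lambda>x. f x + g x) S"
  using assms(2,3)
proof (induction k arbitrary: f g)
  case 0
  then show ?case by (auto intro: continuous_intros)
next
  case (Suc k)
  show ?case
    by (rule Ck_on_SucI[OF assms(1)
          has_derivative_add[OF Ck_on_Suc_has_derivative[OF assms(1) Suc.prems(1)]
            Ck_on_Suc_has_derivative[OF assms(1) Suc.prems(2)]]])
      (use Suc assms in auto)
qed

lemma Ck_on_mult:
  fixes f g :: "'a::real_normed_vector \<Rightarrow> real"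
  assumes "open S" "Ck_on k f S" "Ck_on k g S"
  shows "Ck_on k (\<lambda>x. f x * g x) S"
  using assms(2,3)
proof (induction k arbitrary: f g)
  case 0
  then show ?case by (auto intro: continuous_intros)
next
  case (Suc k)
  have "Ck_on k f S" "Ck_on k g S"
    using Suc.prems Ck_on_SucD[OF assms(1)] by blast+
  then show ?case
    by (intro Ck_on_SucI[OF assms(1)
          has_derivative_mult[OF Ck_on_Suc_has_derivative[OF assms(1) Suc.prems(1)]
            Ck_on_Suc_has_derivative[OF assms(1) Suc.prems(2)]]])
      (use Suc assms in \<open>auto intro!: Ck_on_add\<close>)
qed

lemma Ck_on_sum:
  assumes "open S" "\<And>i. i \<in> I \<Longrightarrow> Ck_on k (f i) S"
  shows "Ck_on k (\<lambda>x. \<Sum>i\<in>I. f i x) S"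
  using assms(2)
  by (induction I rule: infinite_finite_induct)
    (auto intro: Ck_on_const Ck_on_add assms(1))

text \<open>The derivative of \<open>1/f\<close> is again built from \<open>1/f\<close> and the
  derivative of \<open>f\<close> by products, so the induction hypothesis for the same
  \<open>f\<close> is enough.\<close>

lemma Ck_on_inverse:
  fixes f :: "'a::real_normed_vector \<Rightarrow> real"
  assumes "open S" "Ck_on k f S" "\<And>x. x \<in> S \<Longrightarrow> f x \<noteq> 0"
  shows "Ck_on k (\<lambda>x. inverse (f x)) S"
  using assms(2)
proof (induction k)
  case 0
  then show ?case using assms(3) by (auto intro: continuous_intros)
next
  case (Suc k)
  have "Ck_on k (\<lambda>x. inverse (f x)) S"
    using Suc Ck_on_SucD[OF assms(1)] by blast
  then have "Ck_on k (\<lambda>x. (-1) * (inverse (f x) * frechet_derivative f (at x) v * inverse (f x))) S" for v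
    using Suc.prems by (intro Ck_on_mult Ck_on_const assms(1)) auto
  then show ?case
    by (intro Ck_on_SucI[OF assms(1)
          Deriv.has_derivative_inverse[OF assms(3) Ck_on_Suc_has_derivative[OF assms(1) Suc.prems]]])
       auto
qed

text \<open>\<open>Ck_on\<close> controls derivatives in a fixed direction only, whereas the chain
  rule differentiates \<open>g\<close> in the direction \<open>?f' x v\<close>, which moves with
  \<open>x\<close>. Expanding this direction in the basis leaves fixed directions with varying
  coefficients. Only \<open>g\<close> is replaced by its derivatives, so \<open>f\<close> stays
  fixed in the induction.\<close>

lemma Ck_on_compose:
  fixes f :: "'a::real_normed_vector \<Rightarrow> 'b::euclidean_space" and g :: "'b \<Rightarrow> real"
  assumes "open S" "open T" "f ` S \<subseteq> T" "Ck_on k f S" "Ck_on k g T"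
  shows "Ck_on k (\<lambda>x. g (f x)) S"
  using assms(4,5)
proof (induction k arbitrary: g)
  case 0
  then show ?case
    using continuous_on_compose2[of T g S f] assms(3) by simp
next
  case (Suc k)
  let ?g' = "\<lambda>b y. frechet_derivative g (at y) b"
  let ?f' = "\<lambda>x v. frechet_derivative f (at x) v"
  have f: "(f has_derivative ?f' x) (at x)" if "x \<in> S" for x
    using Ck_on_Suc_has_derivative[OF assms(1) Suc.prems(1) that] .
  have g: "(g has_derivative (\<lambda>v. ?g' v (f x))) (at (f x))" if "x \<in> S" for x
    using Ck_on_Suc_has_derivative[OF assms(2) Suc.prems(2)] that assms(3) by blast
  have "((\<lambda>x. g (f x)) has_derivative (\<lambda>v. \<Sum>b\<in>Basis. (?f' x v \<bullet> b) * ?g' b (f x))) (at x)"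
    if "x \<in> S" for x
  proof -
    have lin: "linear (\<lambda>v. ?g' v (f x))"
      using g[OF that] has_derivative_linear by blast
    have "?g' (?f' x v) (f x) = (\<Sum>b\<in>Basis. (?f' x v \<bullet> b) * ?g' b (f x))" for v
    proof -
      have "?g' (?f' x v) (f x) = ?g' (\<Sum>b\<in>Basis. (?f' x v \<bullet> b) *\<^sub>R b) (f x)"
        by (simp add: euclidean_representation)
      also have "\<dots> = (\<Sum>b\<in>Basis. (?f' x v \<bullet> b) * ?g' b (f x))"
        by (simp add: linear_sum[OF lin] linear_cmul[OF lin])
      finally show ?thesis .
    qed
    then show ?thesis
      using has_derivative_compose[OF f[OF that] g[OF that]] by simp
  qed
  moreover have "Ck_on k (\<lambda>x. \<Sum>b\<in>Basis. (?f' x v \<bullet> b) * ?g' b (f x)) S" for v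
  proof (intro Ck_on_sum Ck_on_mult assms(1))
    show "Ck_on k (\<lambda>x. ?f' x v \<bullet> b) S" for b
      using Suc.prems(1)
      by (intro Ck_on_bounded_linear[OF bounded_linear_inner_left] assms(1)) auto
    show "Ck_on k (\<lambda>x. ?g' b (f x)) S" for b
      using Suc.prems Ck_on_SucD[OF assms(1)] by (intro Suc.IH) auto
  qed
  ultimately show ?case
    by (rule Ck_on_SucI[OF assms(1)])
qed

section \<open>Rules for functions of class C^infinity\<close>

lemma smooth_on_cong:
  "\<lbrakk>open S; smooth_on S f; \<And>x. x \<in> S \<Longrightarrow> f x = g x\<rbrakk> \<Longrightarrow> smooth_on S g"
  unfolding smooth_on_def using Ck_on_cong by blast

lemma smooth_on_const: "open S \<Longrightarrow> smooth_on S (\<lambda>x. c)"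
  unfolding smooth_on_def by (simp add: Ck_on_const)

lemma smooth_on_add:
  "\<lbrakk>open S; smooth_on S f; smooth_on S g\<rbrakk> \<Longrightarrow> smooth_on S (\<lambda>x. f x + g x)"
  unfolding smooth_on_def by (simp add: Ck_on_add)

lemma smooth_on_mult:
  fixes f g :: "'a::real_normed_vector \<Rightarrow> real"
  shows "\<lbrakk>open S; smooth_on S f; smooth_on S g\<rbrakk> \<Longrightarrow> smooth_on S (\<lambda>x. f x * g x)"
  unfolding smooth_on_def by (simp add: Ck_on_mult)

lemma smooth_on_inner:
  "open S \<Longrightarrow> smooth_on S (\<lambda>z. z \<bullet> b)"
  unfolding smooth_on_def
  by (simp add: Ck_on_bounded_linear[OF bounded_linear_inner_left] Ck_on_id)

lemma smooth_on_derivative: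
  "smooth_on S f \<Longrightarrow> smooth_on S (\<lambda>x. frechet_derivative f (at x) v)"
  unfolding smooth_on_def using Ck_on.simps(2) by blast

lemma smooth_on_has_derivative:
  "\<lbrakk>open S; smooth_on S f; x \<in> S\<rbrakk> \<Longrightarrow> (f has_derivative frechet_derivative f (at x)) (at x)"
  unfolding smooth_on_def using Ck_on_Suc_has_derivative by blast

lemma smooth_on_compose:
  fixes f :: "'a::real_normed_vector \<Rightarrow> 'b::euclidean_space" and g :: "'b \<Rightarrow> real"
  shows "\<lbrakk>open S; open T; f ` S \<subseteq> T; smooth_on S f; smooth_on T g\<rbrakk> \<Longrightarrow> smooth_on S (\<lambda>x. g (f x))"
  unfolding smooth_on_def using Ck_on_compose by blast

lemma smooth_on_Un:
  "\<lbrakk>open S; open T; smooth_on S f; smooth_on T f\<rbrakk> \<Longrightarrow> smooth_on (S \<union> T) f"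
  unfolding smooth_on_def using Ck_on_Un by blast

lemma smooth_on_subset:
  "\<lbrakk>open S; open T; T \<subseteq> S; smooth_on S f\<rbrakk> \<Longrightarrow> smooth_on T f"
  unfolding smooth_on_def using Ck_on_subset by blast

text \<open>\<open>S\<close> and the complement of the closed ball are two open sets that cover the
  space. On the second one the product is 0, whatever values \<open>f\<close> takes outside
  \<open>S\<close>.\<close>

lemma smooth_on_extend_zero:
  fixes f K :: "'a::euclidean_space \<Rightarrow> real"
  assumes "open S" "cball a r \<subseteq> S" "smooth_on S f" "smooth_on UNIV K"
    and K: "\<And>z. z \<notin> cball a r \<Longrightarrow> K z = 0"
  shows "smooth_on UNIV (\<lambda>z. K z * f z)"
proof -
  have "smooth_on S (\<lambda>z. K z * f z)"
    using assms by (intro smooth_on_mult smooth_on_subset[of UNIV S K]) auto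
  moreover have "smooth_on (- cball a r) (\<lambda>z. K z * f z)"
    by (rule smooth_on_cong[OF _ smooth_on_const[of _ 0]]) (use K in auto)
  ultimately have "smooth_on (S \<union> - cball a r) (\<lambda>z. K z * f z)"
    using assms(1) by (intro smooth_on_Un) auto
  moreover have "S \<union> - cball a r = UNIV"
    using assms(2) by blast
  ultimately show ?thesis by simp
qed

section \<open>Bump functions and Hadamard's lemma\<close>

text \<open>The classical flat function \<open>exp (-1/x)\<close> together with its multiples by
  powers of \<open>1/x\<close>. The derivative of a member is a linear combination of members, so
  one induction on \<open>k\<close> serves the whole family.\<close>

definition exp_flat :: "nat \<Rightarrow> real \<Rightarrow> real" where
  "exp_flat n x = (if x > 0 then inverse x ^ n * exp (- inverse x) else 0)"

lemma exp_flat_nonneg: "exp_flat n x \<ge> 0"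
  and exp_flat_pos: "x > 0 \<Longrightarrow> exp_flat n x > 0"
  and exp_flat_eq_0: "x \<le> 0 \<Longrightarrow> exp_flat n x = 0"
  by (auto simp: exp_flat_def)

lemma exp_flat_tendsto_0: "(exp_flat n \<longlongrightarrow> 0) (at 0)"
proof -
  have "((\<lambda>x::real. inverse x ^ n * exp (- inverse x)) \<longlongrightarrow> 0) (at_right 0)"
  proof (rule filterlim_compose[OF _ filterlim_inverse_at_top_right])
    have "((\<lambda>x::real. x ^ n / exp x) \<longlongrightarrow> 0) at_top"
      by (rule tendsto_power_div_exp_0)
    then show "((\<lambda>x::real. x ^ n * exp (- x)) \<longlongrightarrow> 0) at_top"
      by (simp add: exp_minus divide_inverse)
  qed
  then have "(exp_flat n \<longlongrightarrow> 0) (at_right 0)"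
    by (rule Lim_transform_eventually)
      (auto simp: exp_flat_def eventually_at_filter)
  moreover have "(exp_flat n \<longlongrightarrow> 0) (at_left 0)"
    by (rule Lim_transform_eventually[OF tendsto_const])
      (auto simp: exp_flat_def eventually_at_filter)
  ultimately show ?thesis
    by (simp add: filterlim_split_at)
qed

lemma DERIV_exp_flat:
  "(exp_flat n has_real_derivative exp_flat (n + 2) x - n * exp_flat (Suc n) x) (at x)"
proof (cases x "0 :: real" rule: linorder_cases)
  case less
  have "((\<lambda>x. 0) has_real_derivative 0) (at x)" by simp
  then have "(exp_flat n has_real_derivative 0) (at x)"
    by (rule has_field_derivative_transform_within_open[where S = "{..<0}"])
      (use less in \<open>auto simp: exp_flat_def\<close>)
  then show ?thesis using less by (simp add: exp_flat_eq_0)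
next
  case equal
  \<comment> \<open>Division by \<open>h\<close> raises the exponent by one: the difference quotient
    at 0 is \<open>exp_flat (Suc n) h\<close>.\<close>
  have "((\<lambda>h. exp_flat n h / h) \<longlongrightarrow> 0) (at 0)"
    by (rule Lim_transform_eventually[OF exp_flat_tendsto_0[of "Suc n"]])
      (auto simp: exp_flat_def divide_inverse intro!: always_eventually)
  then show ?thesis
    using equal by (simp add: has_field_derivative_iff exp_flat_eq_0)
next
  case greater
  have "((\<lambda>x. inverse x ^ n * exp (- inverse x)) has_real_derivative
      exp_flat (n + 2) x - n * exp_flat (Suc n) x) (at x)"
  \<comment> \<open>The derivative of the power carries the exponent \<open>n - 1\<close>, a
    truncated subtraction that the case split removes.\<close>
  proof (cases n)
    case 0
    show ?thesis unfolding 0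
      by (rule derivative_eq_intros refl | use greater in \<open>simp add: exp_flat_def power2_eq_square\<close>)+
  next
    case (Suc k)
    show ?thesis unfolding Suc
      by (rule derivative_eq_intros refl | use greater in \<open>simp add: exp_flat_def\<close>)+
  qed
  then show ?thesis
    by (rule has_field_derivative_transform_within_open[where S = "{0<..}"])
      (use greater in \<open>auto simp: exp_flat_def\<close>)
qed

lemma Ck_on_exp_flat: "Ck_on k (exp_flat n) UNIV"
proof (induction k arbitrary: n)
  case 0
  show ?case
    by (auto intro!: continuous_at_imp_continuous_on DERIV_isCont DERIV_exp_flat)
next
  case (Suc k)
  have "Ck_on k (\<lambda>x. (exp_flat (n + 2) x + (- n) * exp_flat (Suc n) x) * v) UNIV" for v
    by (intro Ck_on_add Ck_on_mult Ck_on_const open_UNIV Suc.IH)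
  then show ?case
    using DERIV_exp_flat
    by (intro Ck_on_SucI[where f' = "\<lambda>x v. (exp_flat (n + 2) x - n * exp_flat (Suc n) x) * v"])
      (auto simp: has_field_derivative_def)
qed

text \<open>The quotient \<open>A / (A + C)\<close>, where \<open>A\<close> is positive exactly
  inside radius \<open>2 * R\<close> and \<open>C\<close> exactly outside radius \<open>R\<close>.
  These two regions cover the space, so the denominator never vanishes. Squared distances are used
  because they are smooth at the centre too.\<close>

lemma smooth_bump:
  fixes a :: "'a::euclidean_space"
  assumes "R > 0"
  obtains \<rho> :: "'a \<Rightarrow> real" where "smooth_on UNIV \<rho>"
    "\<And>z. dist a z \<le> R \<Longrightarrow> \<rho> z = 1" "\<And>z. dist a z \<ge> 2 * R \<Longrightarrow> \<rho> z = 0"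
proof
  define A where "A z = exp_flat 0 ((2 * R)\<^sup>2 - (z - a) \<bullet> (z - a))" for z :: 'a
  define C where "C z = exp_flat 0 ((z - a) \<bullet> (z - a) - R\<^sup>2)" for z :: 'a
  let ?\<rho> = "\<lambda>z. A z * inverse (A z + C z)"
  have d: "(z - a) \<bullet> (z - a) = (dist a z)\<^sup>2" for z
    by (simp add: dot_square_norm dist_norm norm_minus_commute)
  show "?\<rho> z = 1" if "dist a z \<le> R" for z
  proof -
    have "(dist a z)\<^sup>2 \<le> R\<^sup>2" "(dist a z)\<^sup>2 < (2 * R)\<^sup>2"
      using that assms by (intro power_mono power_strict_mono; simp)+
    then have "A z > 0" "C z = 0"
      by (auto simp: A_def C_def d intro!: exp_flat_pos exp_flat_eq_0)
    then show ?thesis by simp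
  qed
  show "?\<rho> z = 0" if "dist a z \<ge> 2 * R" for z
  proof -
    have "(2 * R)\<^sup>2 \<le> (dist a z)\<^sup>2" using that assms by (intro power_mono) auto
    then show ?thesis by (simp add: A_def d exp_flat_eq_0)
  qed
  have pos: "A z + C z \<noteq> 0" for z
  proof (cases "dist a z \<le> R")
    case True
    then have "(dist a z)\<^sup>2 < (2 * R)\<^sup>2" using assms by (intro power_strict_mono) auto
    then have "A z > 0" by (auto simp: A_def d intro!: exp_flat_pos)
    then show ?thesis using exp_flat_nonneg[of 0 "(z - a) \<bullet> (z - a) - R\<^sup>2"] by (simp add: C_def)
  next
    case False
    then have "R\<^sup>2 < (dist a z)\<^sup>2" using assms by (intro power_strict_mono) auto
    then have "C z > 0" by (auto simp: C_def d intro!: exp_flat_pos)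
    then show ?thesis using exp_flat_nonneg[of 0 "(2 * R)\<^sup>2 - (z - a) \<bullet> (z - a)"]
      by (simp add: A_def)
  qed
  have sq: "Ck_on k (\<lambda>z. (z - a) \<bullet> (z - a)) UNIV" for k
  proof -
    have "Ck_on k (\<lambda>z. \<Sum>b\<in>Basis. (z \<bullet> b + - (a \<bullet> b)) * (z \<bullet> b + - (a \<bullet> b))) UNIV"
      by (intro Ck_on_sum Ck_on_mult Ck_on_add Ck_on_const open_UNIV
          Ck_on_bounded_linear[OF bounded_linear_inner_left] Ck_on_id)
    then show ?thesis
      by (subst euclidean_inner) (simp add: inner_diff_left)
  qed
  have "Ck_on k A UNIV" for k
  proof -
    have "Ck_on k (\<lambda>z. exp_flat 0 ((2 * R)\<^sup>2 + (- 1) * ((z - a) \<bullet> (z - a)))) UNIV"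
      by (rule Ck_on_compose[where T = UNIV])
        (intro Ck_on_exp_flat Ck_on_mult Ck_on_add Ck_on_const sq open_UNIV subset_UNIV)+
    then show ?thesis by (simp add: A_def[abs_def])
  qed
  moreover have "Ck_on k C UNIV" for k
  proof -
    have "Ck_on k (\<lambda>z. exp_flat 0 ((z - a) \<bullet> (z - a) + - R\<^sup>2)) UNIV"
      by (rule Ck_on_compose[where T = UNIV])
        (intro Ck_on_exp_flat Ck_on_mult Ck_on_add Ck_on_const sq open_UNIV subset_UNIV)+
    then show ?thesis by (simp add: C_def[abs_def])
  qed
  ultimately show "smooth_on UNIV ?\<rho>"
    using pos unfolding smooth_on_def by (intro allI Ck_on_mult Ck_on_inverse Ck_on_add) auto
qed

text \<open>Differentiating \<open>f (c + t *\<^sub>R (z - c))\<close> in \<open>z\<close> produces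
  a factor \<open>t\<close>. The weight \<open>t ^ j\<close> is there so that the derivative of such
  an integral is an integral of the same kind, with \<open>Suc j\<close>.\<close>

lemma Ck_on_segment_integral:
  fixes f :: "'a::euclidean_space \<Rightarrow> real"
  assumes "Ck_on k f UNIV"
  shows "Ck_on k (\<lambda>z. integral {0..1} (\<lambda>t. t ^ j * f (c + t *\<^sub>R (z - c)))) UNIV"
  using assms
proof (induction k arbitrary: f j)
  case 0
  then have "continuous_on (UNIV \<times> cbox 0 1) (\<lambda>(z, t). t ^ j * f (c + t *\<^sub>R (z - c)))"
    unfolding split_beta by (auto intro!: continuous_intros continuous_on_compose2[of UNIV f])
  then show ?case
    using integral_continuous_on_param[of UNIV "0::real" 1 "\<lambda>z t. t ^ j * f (c + t *\<^sub>R (z - c))"]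
    by simp
next
  case (Suc k)
  let ?f' = "\<lambda>v y. frechet_derivative f (at y) v"
  let ?g = "\<lambda>z t. t ^ j * f (c + t *\<^sub>R (z - c))"
  \<comment> \<open>Differentiation under the integral by \<open>leibniz_rule\<close> asks for a
    derivative that is continuous as a map into bounded linear functions; this continuity is later
    checked componentwise.\<close>
  define D where "D z t = Blinfun (\<lambda>v. t ^ Suc j * ?f' v (c + t *\<^sub>R (z - c)))" for z and t :: real
  have f: "(f has_derivative (\<lambda>v. ?f' v y)) (at y)" for y
    using Ck_on_Suc_has_derivative[OF open_UNIV Suc.prems] by simp
  have bl: "bounded_linear (\<lambda>v. ?f' v y)" for y
    using f by (rule has_derivative_bounded_linear)
  have D: "blinfun_apply (D z t) = (\<lambda>v. t ^ Suc j * ?f' v (c + t *\<^sub>R (z - c)))" for z t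
    unfolding D_def by (intro bounded_linear_Blinfun_apply bounded_linear_const_mult bl)
  have g: "((\<lambda>z. ?g z t) has_derivative D z t) (at z)" for z t
  proof -
    have 1: "((\<lambda>z. c + t *\<^sub>R (z - c)) has_derivative (\<lambda>v. t *\<^sub>R v)) (at z)"
      by (auto intro!: derivative_eq_intros)
    have "?f' (t *\<^sub>R v) y = t * ?f' v y" for v y
      using linear_cmul[OF bounded_linear.linear[OF bl]] by simp
    then show ?thesis
      using has_derivative_mult_right[OF has_derivative_compose[OF 1 f], of "t ^ j"]
      by (simp add: D mult_ac)
  qed
  have cf: "continuous_on UNIV f"
    using Suc.prems differentiable_imp_continuous_on by auto
  have cont': "continuous_on UNIV (?f' v)" for v
  proof -
    have "Ck_on k (?f' v) UNIV" using Suc.prems by simp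
    then show ?thesis
      by (cases k) (auto intro: differentiable_imp_continuous_on)
  qed
  have contD: "continuous_on (UNIV \<times> cbox 0 1) (\<lambda>(z, t). D z t)"
    unfolding split_beta
    by (rule continuous_on_blinfun_componentwise)
      (auto simp: D intro!: continuous_intros continuous_on_compose2[OF cont'])
  have gint: "?g z integrable_on cbox 0 1" for z
    by (intro integrable_continuous)
      (auto intro!: continuous_intros continuous_on_compose2[OF cf])
  have "((\<lambda>z. integral (cbox 0 1) (?g z)) has_derivative integral (cbox 0 1) (D z)) (at z)" for z
    using leibniz_rule[of UNIV "0::real" 1 ?g D z, OF _ gint contD] g by simp
  moreover have "blinfun_apply (integral (cbox 0 1) (D z)) v
      = integral {0..1} (\<lambda>t. t ^ Suc j * ?f' v (c + t *\<^sub>R (z - c)))" for z v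
  proof -
    have "continuous_on (cbox 0 1) (D z)"
    proof -
      have "continuous_on (cbox 0 1) (\<lambda>t. (z, t))" by (intro continuous_intros)
      then show ?thesis
        using continuous_on_compose2[OF contD] by fastforce
    qed
    then have "D z integrable_on cbox 0 1" by (rule integrable_continuous)
    then show ?thesis
      using blinfun_apply_integral by (simp add: blinfun_apply_integral D)
  qed
  ultimately have "((\<lambda>z. integral {0..1} (?g z)) has_derivative
      (\<lambda>v. integral {0..1} (\<lambda>t. t ^ Suc j * ?f' v (c + t *\<^sub>R (z - c))))) (at z)" for z
    by (metis (no_types, lifting) cbox_interval ext)
  moreover have "Ck_on k (\<lambda>z. integral {0..1} (\<lambda>t. t ^ Suc j * ?f' v (c + t *\<^sub>R (z - c)))) UNIV" for v
    using Suc.prems by (intro Suc.IH) auto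
  ultimately show ?case
    by (rule Ck_on_SucI[OF open_UNIV])
qed

text \<open>The fundamental theorem of calculus along the segment from \<open>c\<close> to
  \<open>z\<close>, with the direction \<open>z - c\<close> expanded in the basis. At
  \<open>z = c\<close> the integrand is constant, which gives the value of
  \<open>h b c\<close>.\<close>

lemma hadamard:
  fixes f :: "'a::euclidean_space \<Rightarrow> real"
  assumes f: "smooth_on UNIV f"
  obtains h where "\<And>b. smooth_on UNIV (h b)"
    "\<And>b. h b c = frechet_derivative f (at c) b"
    "\<And>z. f z = f c + (\<Sum>b\<in>Basis. (z \<bullet> b - c \<bullet> b) * h b z)"
proof
  let ?f' = "\<lambda>v y. frechet_derivative f (at y) v"
  \<comment> \<open>The factor \<open>t ^ 0\<close> brings the integral into the form of
    \<open>Ck_on_segment_integral\<close> with \<open>j = 0\<close>.\<close>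
  let ?h = "\<lambda>b z. integral {0..1} (\<lambda>t. t ^ 0 * ?f' b (c + t *\<^sub>R (z - c)))"
  have C: "Ck_on (Suc k) f UNIV" for k
    using f unfolding smooth_on_def by blast
  have der: "(f has_derivative (\<lambda>v. ?f' v y)) (at y)" for y
    using Ck_on_Suc_has_derivative[OF open_UNIV C] by simp
  have cont': "continuous_on UNIV (?f' v)" for v
    using C[of 0] by simp
  show "smooth_on UNIV (?h b)" for b
    using C unfolding smooth_on_def by (intro allI Ck_on_segment_integral) auto
  show "?h b c = ?f' b c" for b by simp
  show "f z = f c + (\<Sum>b\<in>Basis. (z \<bullet> b - c \<bullet> b) * ?h b z)" for z
  proof -
    have lin: "linear (\<lambda>v. ?f' v y)" for y using der has_derivative_linear by blast
    have "((\<lambda>t. f (c + t *\<^sub>R (z - c))) has_vector_derivative ?f' (z - c) (c + t *\<^sub>R (z - c)))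
        (at t within {0..1})" for t
    proof -
      have 1: "((\<lambda>t. c + t *\<^sub>R (z - c)) has_derivative (\<lambda>s. s *\<^sub>R (z - c))) (at t within {0..1})"
        by (auto intro!: derivative_eq_intros)
      show ?thesis
        using has_derivative_compose[OF 1 der] linear_cmul[OF lin]
        by (simp add: has_vector_derivative_def)
    qed
    then have "((\<lambda>t. ?f' (z - c) (c + t *\<^sub>R (z - c))) has_integral
        f (c + 1 *\<^sub>R (z - c)) - f (c + 0 *\<^sub>R (z - c))) {0..1}"
      by (intro fundamental_theorem_of_calculus) auto
    moreover have "?f' (z - c) y = (\<Sum>b\<in>Basis. (z \<bullet> b - c \<bullet> b) * ?f' b y)" for y
    proof -
      have "?f' (z - c) y = ?f' (\<Sum>b\<in>Basis. ((z - c) \<bullet> b) *\<^sub>R b) y"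
        by (simp add: euclidean_representation)
      then show ?thesis
        by (simp add: linear_sum[OF lin] linear_cmul[OF lin] inner_diff_left)
    qed
    ultimately have "f z - f c = integral {0..1}
        (\<lambda>t. \<Sum>b\<in>Basis. (z \<bullet> b - c \<bullet> b) * ?f' b (c + t *\<^sub>R (z - c)))"
      by (simp add: integral_unique)
    also have "\<dots> = (\<Sum>b\<in>Basis. (z \<bullet> b - c \<bullet> b) * ?h b z)"
      by (subst integral_sum)
        (auto intro!: integrable_continuous_real continuous_intros continuous_on_compose2[OF cont'])
    finally show ?thesis by simp
  qed
qed

section \<open>Smooth functions, tangent vectors and local frames\<close>

lemma smooth_atlas_chart:
  assumes "smooth_atlas M" "(U, \<phi>) \<in> M"
  shows "open U" "open (\<phi> ` U)" "homeomorphism U (\<phi> ` U) \<phi> (inv_into U \<phi>)"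
  using bspec[OF conjunct1[OF conjunct2[OF assms(1)[unfolded smooth_atlas_def]]] assms(2)]
  by auto

lemma smooth_atlas_transition:
  assumes "smooth_atlas M" "(U, \<phi>) \<in> M" "(V, \<psi>) \<in> M"
  shows "smooth_on (\<phi> ` (U \<inter> V)) (\<psi> \<circ> inv_into U \<phi>)"
  using bspec[OF conjunct2[OF conjunct2[OF assms(1)[unfolded smooth_atlas_def]]] assms(2)] assms(3)
  by auto

lemma smooth_atlas_chart_at:
  assumes "smooth_atlas M"
  obtains U \<phi> where "(U, \<phi>) \<in> M" "x \<in> U"
proof -
  have "x \<in> (\<Union>(U, \<phi>)\<in>M. U)"
    using assms by (simp add: smooth_atlas_def)
  then show ?thesis using that by auto
qed

lemma open_chart_image:
  assumes "smooth_atlas M" "(U, \<phi>) \<in> M" "open W" "W \<subseteq> U"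
  shows "open (\<phi> ` W)"
proof -
  have "openin (top_of_set (\<phi> ` U)) (\<phi> ` W)"
    using homeomorphism_imp_open_map[OF smooth_atlas_chart(3)[OF assms(1,2)]] assms(3,4)
      smooth_atlas_chart(1)[OF assms(1,2)] by (metis openin_open_eq)
  then show ?thesis
    using smooth_atlas_chart(2)[OF assms(1,2)] openin_open_trans by blast
qed

lemma smooth_fun_chart:
  "\<lbrakk>f \<in> smooth_fun M; (U, \<phi>) \<in> M\<rbrakk> \<Longrightarrow> smooth_on (\<phi> ` U) (f \<circ> inv_into U \<phi>)"
  unfolding smooth_fun_def by auto

lemma smooth_fun_const:
  assumes "smooth_atlas M" shows "(\<lambda>x. c) \<in> smooth_fun M"
  unfolding smooth_fun_def o_def
  using smooth_atlas_chart[OF assms] by (auto intro: smooth_on_const)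

lemma smooth_fun_add:
  assumes "smooth_atlas M" "f \<in> smooth_fun M" "g \<in> smooth_fun M"
  shows "(\<lambda>x. f x + g x) \<in> smooth_fun M"
  unfolding smooth_fun_def
proof clarify
  fix U \<phi> assume c: "(U, \<phi>) \<in> M"
  show "smooth_on (\<phi> ` U) ((\<lambda>x. f x + g x) \<circ> inv_into U \<phi>)"
    using smooth_on_add[OF smooth_atlas_chart(2)[OF assms(1) c] smooth_fun_chart[OF assms(2) c]
        smooth_fun_chart[OF assms(3) c]] by (simp add: o_def)
qed

lemma smooth_fun_mult:
  assumes "smooth_atlas M" "f \<in> smooth_fun M" "g \<in> smooth_fun M"
  shows "(\<lambda>x. f x * g x) \<in> smooth_fun M"
  unfolding smooth_fun_def
proof clarify
  fix U \<phi> assume c: "(U, \<phi>) \<in> M"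
  show "smooth_on (\<phi> ` U) ((\<lambda>x. f x * g x) \<circ> inv_into U \<phi>)"
    using smooth_on_mult[OF smooth_atlas_chart(2)[OF assms(1) c] smooth_fun_chart[OF assms(2) c]
        smooth_fun_chart[OF assms(3) c]] by (simp add: o_def)
qed

lemma smooth_fun_sum:
  assumes "smooth_atlas M" "\<And>i. i \<in> I \<Longrightarrow> f i \<in> smooth_fun M"
  shows "(\<lambda>x. \<Sum>i\<in>I. f i x) \<in> smooth_fun M"
  using assms(2)
  by (induction I rule: infinite_finite_induct)
    (auto intro: smooth_fun_const smooth_fun_add assms(1))

text \<open>Smoothness has to be checked in every other chart. The preimage \<open>C\<close> of the
  ball is compact, hence closed in the Hausdorff space, so any chart domain is covered by two open
  pieces: its overlap with \<open>U\<close>, where a transition map applies, and the complement of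
  \<open>C\<close>, where the function is 0.\<close>

lemma smooth_fun_pullback:
  fixes K :: "'e::euclidean_space \<Rightarrow> real"
    and M :: "('m::{second_countable_topology,t2_space}, 'e) atlas"
  assumes M: "smooth_atlas M" and U: "(U, \<phi>) \<in> M" and "cball a r \<subseteq> \<phi> ` U"
    and K: "smooth_on UNIV K" "\<And>z. z \<notin> cball a r \<Longrightarrow> K z = 0"
  shows "(\<lambda>x. if x \<in> U then K (\<phi> x) else 0) \<in> smooth_fun M"
  unfolding smooth_fun_def
proof clarify
  let ?f = "\<lambda>x. if x \<in> U then K (\<phi> x) else 0"
  note hU = smooth_atlas_chart[OF M U]
  fix V \<psi> assume V: "(V, \<psi>) \<in> M"
  note hV = smooth_atlas_chart[OF M V]
  define C where "C = inv_into U \<phi> ` cball a r"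
  have "compact C"
    unfolding C_def using hU(3) assms(3)
    by (intro compact_continuous_image) (auto simp: homeomorphism_def intro: continuous_on_subset)
  then have oC: "open (- C)" by (simp add: compact_imp_closed open_Compl)
  have inv: "inv_into V \<psi> (\<psi> x) = x" if "x \<in> V" for x
    using hV(3) that by (simp add: homeomorphism_def)
  have f0: "K (\<phi> x) = 0" if "x \<notin> C" "x \<in> U" for x
  proof -
    have "inv_into U \<phi> (\<phi> x) = x" using hU(3) that(2) by (simp add: homeomorphism_def)
    then have "\<phi> x \<notin> cball a r" using that(1) by (metis C_def image_eqI)
    then show ?thesis by (simp add: K(2))
  qed
  have o1: "open (\<psi> ` (V \<inter> U))" and o2: "open (\<psi> ` (V \<inter> - C))"
    using hU hV oC by (auto intro!: open_chart_image[OF M V])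
  have "smooth_on (\<psi> ` (V \<inter> U)) (\<lambda>z. K ((\<phi> \<circ> inv_into V \<psi>) z))"
    by (rule smooth_on_compose[OF o1 open_UNIV subset_UNIV smooth_atlas_transition[OF M V U] K(1)])
  then have 1: "smooth_on (\<psi> ` (V \<inter> U)) (?f \<circ> inv_into V \<psi>)"
    by (rule smooth_on_cong[OF o1]) (auto simp: inv)
  have 2: "smooth_on (\<psi> ` (V \<inter> - C)) (?f \<circ> inv_into V \<psi>)"
    by (rule smooth_on_cong[OF o2 smooth_on_const[OF o2, of 0]]) (use f0 in \<open>auto simp: inv\<close>)
  have "C \<subseteq> U" unfolding C_def using assms(3) hU(3) by (auto simp: homeomorphism_def)
  then have "\<psi> ` (V \<inter> U) \<union> \<psi> ` (V \<inter> - C) = \<psi> ` V" by blast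
  then show "smooth_on (\<psi> ` V) (?f \<circ> inv_into V \<psi>)"
    using smooth_on_Un[OF o1 o2 1 2] by simp
qed

section \<open>Tangent vectors as derivations\<close>

lemma tangent_add:
  "\<lbrakk>v \<in> tangent_space M x; f \<in> smooth_fun M; g \<in> smooth_fun M\<rbrakk>
    \<Longrightarrow> v (\<lambda>y. f y + g y) = v f + v g"
  unfolding tangent_space_def plus_fun_def by blast

lemma tangent_mult:
  "\<lbrakk>v \<in> tangent_space M x; f \<in> smooth_fun M; g \<in> smooth_fun M\<rbrakk>
    \<Longrightarrow> v (\<lambda>y. f y * g y) = v f * g x + f x * v g"
  unfolding tangent_space_def times_fun_def by blast

lemma tangent_scale:
  "\<lbrakk>v \<in> tangent_space M x; f \<in> smooth_fun M\<rbrakk> \<Longrightarrow> v (\<lambda>y. c * f y) = c * v f"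
  unfolding tangent_space_def by blast

lemma tangent_nonsmooth:
  "\<lbrakk>v \<in> tangent_space M x; f \<notin> smooth_fun M\<rbrakk> \<Longrightarrow> v f = 0"
  unfolding tangent_space_def by blast

lemma tangentI:
  assumes "\<And>f g. \<lbrakk>f \<in> smooth_fun M; g \<in> smooth_fun M\<rbrakk> \<Longrightarrow> v (\<lambda>y. f y + g y) = v f + v g"
    and "\<And>f g. \<lbrakk>f \<in> smooth_fun M; g \<in> smooth_fun M\<rbrakk>
      \<Longrightarrow> v (\<lambda>y. f y * g y) = v f * g x + f x * v g"
    and "\<And>f c. f \<in> smooth_fun M \<Longrightarrow> v (\<lambda>y. c * f y) = c * v f"
    and "\<And>f. f \<notin> smooth_fun M \<Longrightarrow> v f = 0"
  shows "v \<in> tangent_space M x"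
  using assms unfolding tangent_space_def plus_fun_def times_fun_def by blast

lemma tangent_const:
  assumes "smooth_atlas M" "v \<in> tangent_space M x"
  shows "v (\<lambda>y. c) = 0"
proof -
  have "v (\<lambda>y. 1 * 1) = v (\<lambda>y. 1) + v (\<lambda>y. 1)"
    using tangent_mult[OF assms(2) smooth_fun_const[OF assms(1), of 1]
        smooth_fun_const[OF assms(1), of 1]] by simp
  then have "v (\<lambda>y. 1) = 0" by simp
  then show ?thesis
    using tangent_scale[OF assms(2) smooth_fun_const[OF assms(1)], of c 1] by simp
qed

lemma tangent_sum:
  assumes "smooth_atlas M" "v \<in> tangent_space M x" "\<And>i. i \<in> I \<Longrightarrow> f i \<in> smooth_fun M"
  shows "v (\<lambda>y. \<Sum>i\<in>I. f i y) = (\<Sum>i\<in>I. v (f i))"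
  using assms(3)
proof (induction I rule: infinite_finite_induct)
  case (insert i I)
  have "v (\<lambda>y. f i y + (\<Sum>i\<in>I. f i y)) = v (f i) + v (\<lambda>y. \<Sum>i\<in>I. f i y)"
    using insert by (intro tangent_add[OF assms(2)] smooth_fun_sum assms(1)) auto
  then show ?case using insert by simp
qed (auto intro: tangent_const[OF assms(1,2)])

lemma tangent_space_lincomb:
  assumes "v \<in> tangent_space M x" "w \<in> tangent_space M x"
  shows "(\<lambda>f. c * v f + d * w f) \<in> tangent_space M x"
  by (rule tangentI)
    (use assms in \<open>simp_all add: tangent_add tangent_mult tangent_scale tangent_nonsmooth algebra_simps\<close>)

lemma tangent_space_zero: "(\<lambda>f. 0) \<in> tangent_space M x"
  by (rule tangentI) auto

lemma tangent_space_add: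
  assumes "v \<in> tangent_space M x" "w \<in> tangent_space M x"
  shows "(\<lambda>f. v f + w f) \<in> tangent_space M x"
  using tangent_space_lincomb[OF assms, of 1 1] by simp

lemma tangent_space_diff:
  assumes "v \<in> tangent_space M x" "w \<in> tangent_space M x"
  shows "(\<lambda>f. v f - w f) \<in> tangent_space M x"
  using tangent_space_lincomb[OF assms, of 1 "-1"] by simp

lemma tangent_space_scale:
  assumes "v \<in> tangent_space M x"
  shows "(\<lambda>f. c * v f) \<in> tangent_space M x"
  using tangent_space_lincomb[OF assms tangent_space_zero, of c 1] by simp

lemma tangent_space_sum:
  assumes "\<And>i. i \<in> I \<Longrightarrow> v i \<in> tangent_space M x"
  shows "(\<lambda>f. \<Sum>i\<in>I. c i * v i f) \<in> tangent_space M x"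
  using assms
proof (induction I rule: infinite_finite_induct)
  case (insert i I)
  then show ?case
    using tangent_space_lincomb[of "v i" M x "\<lambda>f. \<Sum>i\<in>I. c i * v i f" "c i" 1] by simp
qed (auto intro: tangent_space_zero)

lemma vector_fieldsI:
  assumes "\<And>x. u x \<in> tangent_space M x"
    and "\<And>f. f \<in> smooth_fun M \<Longrightarrow> (\<lambda>x. u x f) \<in> smooth_fun M"
  shows "u \<in> vector_fields M"
  using assms unfolding vector_fields_def by blast

lemma vector_fieldsD:
  assumes "u \<in> vector_fields M"
  shows "u x \<in> tangent_space M x" "f \<in> smooth_fun M \<Longrightarrow> (\<lambda>x. u x f) \<in> smooth_fun M"
  using assms unfolding vector_fields_def by blast+

text \<open>A chart-free form of a frame near \<open>x\<close>. Everything is global, and the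
  expansion with the factor \<open>\<psi> y\<close> is required at every \<open>y\<close>. In this
  way it expands whole vector fields and not only vectors at \<open>x\<close>; at \<open>x\<close>
  itself the factor is 1.\<close>

definition local_frame :: "('m::topological_space, 'e::euclidean_space) atlas \<Rightarrow> 'm \<Rightarrow>
    ('e \<Rightarrow> 'm \<Rightarrow> real) \<Rightarrow> ('e \<Rightarrow> 'm vector_field) \<Rightarrow> ('m \<Rightarrow> real) \<Rightarrow> bool" where
  "local_frame M x \<xi> E \<psi> \<longleftrightarrow> (\<forall>b. \<xi> b \<in> smooth_fun M) \<and> (\<forall>b. E b \<in> vector_fields M) \<and>
     \<psi> \<in> smooth_fun M \<and> \<psi> x = 1 \<and>
     (\<forall>y. \<forall>v\<in>tangent_space M y. \<forall>f. \<psi> y * v f = (\<Sum>b\<in>Basis. v (\<xi> b) * E b y f))"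

lemma local_frameD:
  assumes "local_frame M x \<xi> E \<psi>"
  shows "\<xi> b \<in> smooth_fun M" "E b \<in> vector_fields M" "\<psi> \<in> smooth_fun M" "\<psi> x = 1"
    "v \<in> tangent_space M y \<Longrightarrow> \<psi> y * v f = (\<Sum>b\<in>Basis. v (\<xi> b) * E b y f)"
  using assms unfolding local_frame_def by blast+

text \<open>\<open>E\<close> consists of coordinate fields multiplied by a bump function \<open>\<psi>\<close>, and \<open>\<xi>\<close> of the
  coordinate functions multiplied by a bump function that is \<open>1\<close> on the support of \<open>\<psi>\<close>.\<close>

lemma local_frame_exists:
  fixes M :: "('m::{second_countable_topology,t2_space}, 'e::euclidean_space) atlas"
  assumes M: "smooth_atlas M"
  obtains \<xi> E \<psi> where "local_frame M x \<xi> E \<psi>"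
proof -
  obtain U \<phi> where U: "(U, \<phi>) \<in> M" "x \<in> U"
    using smooth_atlas_chart_at[OF M] by blast
  note hU = smooth_atlas_chart[OF M U(1)]
  define a where "a = \<phi> x"
  obtain e where e: "e > 0" "cball a e \<subseteq> \<phi> ` U"
    using hU(2) U(2) open_contains_cball a_def by blast
  obtain \<rho> :: "'e \<Rightarrow> real" where \<rho>: "smooth_on UNIV \<rho>"
    "\<And>z. dist a z \<le> e / 2 \<Longrightarrow> \<rho> z = 1" "\<And>z. dist a z \<ge> e \<Longrightarrow> \<rho> z = 0"
    using smooth_bump[of "e / 2" a] e(1) by auto
  obtain \<rho>' :: "'e \<Rightarrow> real" where \<rho>': "smooth_on UNIV \<rho>'"
    "\<And>z. dist a z \<le> e / 4 \<Longrightarrow> \<rho>' z = 1" "\<And>z. dist a z \<ge> e / 2 \<Longrightarrow> \<rho>' z = 0"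
    using smooth_bump[of "e / 4" a] e(1) by auto
  define pull where "pull K = (\<lambda>y. if y \<in> U then K (\<phi> y) else 0)" for K :: "'e \<Rightarrow> real"
  have pull: "pull (\<lambda>z. k z * K z) \<in> smooth_fun M"
    if "smooth_on UNIV k" "smooth_on UNIV K" "\<And>z. dist a z \<ge> e \<Longrightarrow> k z = 0" for k K
    unfolding pull_def using that
    by (intro smooth_fun_pullback[OF M U(1) e(2)] smooth_on_mult) auto
  have extend: "smooth_on UNIV (\<lambda>z. k z * K z)"
    if "smooth_on UNIV k" "smooth_on (\<phi> ` U) K" "\<And>z. dist a z \<ge> e \<Longrightarrow> k z = 0" for k K :: "'e \<Rightarrow> real"
    by (rule smooth_on_extend_zero[OF hU(2) e(2) that(2,1)]) (use that(3) in auto)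
  define \<psi> where "\<psi> = pull \<rho>'"
  define \<xi> where "\<xi> b = pull (\<lambda>z. \<rho> z * (z \<bullet> b))" for b
  define D where "D b f z = frechet_derivative (f \<circ> inv_into U \<phi>) (at z) b"
    for b z and f :: "'m \<Rightarrow> real"
  define E where "E b y f = (if f \<in> smooth_fun M then pull (\<lambda>z. \<rho>' z * D b f z) y else 0)" for b y f
  have \<rho>'0: "\<rho>' z = 0" if "dist a z \<ge> e" for z
    using that e(1) \<rho>'(3) by simp
  have \<psi>: "\<psi> \<in> smooth_fun M"
    using pull[OF \<rho>'(1) smooth_on_const[of _ 1] \<rho>'0] by (simp add: \<psi>_def)
  have \<xi>: "\<xi> b \<in> smooth_fun M" for b
    unfolding \<xi>_def by (intro pull \<rho> smooth_on_inner open_UNIV)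
  have \<psi>x: "\<psi> x = 1"
    using U(2) e(1) by (simp add: \<psi>_def pull_def \<rho>'(2) flip: a_def)
  have inv: "inv_into U \<phi> (\<phi> y) = y" "\<phi> y \<in> \<phi> ` U" if "y \<in> U" for y
    using hU(3) that by (auto simp: homeomorphism_def)
  have der: "(f \<circ> inv_into U \<phi> has_derivative (\<lambda>b. D b f (\<phi> y))) (at (\<phi> y))"
    if "f \<in> smooth_fun M" "y \<in> U" for f y
    unfolding D_def
    using smooth_on_has_derivative[OF hU(2) smooth_fun_chart[OF that(1) U(1)] inv(2)[OF that(2)]] .
  have E: "E b \<in> vector_fields M" for b
  proof (rule vector_fieldsI)
    fix y
    show "E b y \<in> tangent_space M y"
    proof (cases "y \<in> U")
      case False
      then have "E b y = (\<lambda>f. 0)" by (auto simp: E_def pull_def)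
      then show ?thesis by (simp add: tangent_space_zero)
    next
      case True
      note der = der[OF _ True]
      show ?thesis
      proof (rule tangentI)
        fix f g assume fg: "f \<in> smooth_fun M" "g \<in> smooth_fun M"
        have "((\<lambda>z. (f \<circ> inv_into U \<phi>) z + (g \<circ> inv_into U \<phi>) z) has_derivative
            (\<lambda>b. D b f (\<phi> y) + D b g (\<phi> y))) (at (\<phi> y))"
          by (intro has_derivative_add der fg)
        from fun_cong[OF frechet_derivative_at[OF this], of b, symmetric]
        have "D b (\<lambda>y. f y + g y) (\<phi> y) = D b f (\<phi> y) + D b g (\<phi> y)"
          by (simp add: D_def o_def)
        then show "E b y (\<lambda>y. f y + g y) = E b y f + E b y g"
          using fg smooth_fun_add[OF M fg] by (simp add: E_def pull_def True algebra_simps)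
        have "((\<lambda>z. (f \<circ> inv_into U \<phi>) z * (g \<circ> inv_into U \<phi>) z) has_derivative
            (\<lambda>b. (f \<circ> inv_into U \<phi>) (\<phi> y) * D b g (\<phi> y) + D b f (\<phi> y) * (g \<circ> inv_into U \<phi>) (\<phi> y)))
            (at (\<phi> y))"
          by (intro has_derivative_mult der fg)
        from fun_cong[OF frechet_derivative_at[OF this], of b, symmetric]
        have "D b (\<lambda>y. f y * g y) (\<phi> y) = f y * D b g (\<phi> y) + D b f (\<phi> y) * g y"
          by (simp add: D_def o_def inv True)
        then show "E b y (\<lambda>y. f y * g y) = E b y f * g y + f y * E b y g"
          using fg smooth_fun_mult[OF M fg] by (simp add: E_def pull_def True algebra_simps)
      next
        fix f c assume f: "f \<in> smooth_fun M"
        have "((\<lambda>z. c * (f \<circ> inv_into U \<phi>) z) has_derivative (\<lambda>b. c * D b f (\<phi> y))) (at (\<phi> y))"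
          by (intro has_derivative_mult_right der f)
        from fun_cong[OF frechet_derivative_at[OF this], of b, symmetric]
        have "D b (\<lambda>y. c * f y) (\<phi> y) = c * D b f (\<phi> y)"
          by (simp add: D_def o_def)
        then show "E b y (\<lambda>y. c * f y) = c * E b y f"
          using f smooth_fun_mult[OF M smooth_fun_const[OF M] f]
          by (simp add: E_def pull_def True algebra_simps)
      qed (simp add: E_def)
    qed
  next
    fix f assume f: "f \<in> smooth_fun M"
    have "smooth_on (\<phi> ` U) (D b f)"
      unfolding D_def by (rule smooth_on_derivative[OF smooth_fun_chart[OF f U(1)]])
    then have "smooth_on UNIV (\<lambda>z. \<rho>' z * D b f z)"
      by (intro extend \<rho>' \<rho>'0)
    then have "pull (\<lambda>z. \<rho>' z * D b f z) \<in> smooth_fun M"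
      unfolding pull_def using \<rho>'0 by (intro smooth_fun_pullback[OF M U(1) e(2)]) auto
    then show "(\<lambda>x. E b x f) \<in> smooth_fun M"
      using f by (simp add: E_def)
  qed
  have main: "\<psi> y * v f = (\<Sum>b\<in>Basis. v (\<xi> b) * E b y f)" if v: "v \<in> tangent_space M y" for y v f
  proof (cases "f \<in> smooth_fun M \<and> \<psi> y \<noteq> 0")
    case False
    then consider "f \<notin> smooth_fun M" | "\<psi> y = 0" by blast
    then show ?thesis
    proof cases
      case 1
      then show ?thesis using tangent_nonsmooth[OF v] by (simp add: E_def)
    next
      case 2
      then have "E b y f = 0" for b by (auto simp: E_def pull_def \<psi>_def)
      with 2 show ?thesis by simp
    qed
  next
    case True
    then have f: "f \<in> smooth_fun M" and y: "y \<in> U" "\<rho>' (\<phi> y) \<noteq> 0"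
      by (auto simp: \<psi>_def pull_def split: if_splits)
    \<comment> \<open>The strict bound puts points with \<open>\<rho>' z \<noteq> 0\<close> into the
      open ball on which \<open>\<rho> = 1\<close>, so derivatives there do not notice the cut-off
      by \<open>\<rho>\<close>.\<close>
    have near: "dist a z < e / 2" if "\<rho>' z \<noteq> 0" for z
      using \<rho>'(3)[of z] that by force
    define c where "c = \<phi> y"
    \<comment> \<open>\<open>hadamard\<close> needs a function that is smooth on the whole model
      space, so the chart expression of \<open>f\<close>, meaningful on the chart image only, is cut
      off by \<open>\<rho>\<close>.\<close>
    define F where "F z = \<rho> z * (f \<circ> inv_into U \<phi>) z" for z
    have F: "smooth_on UNIV F"
      unfolding F_def by (intro extend \<rho> smooth_fun_chart[OF f U(1)])
    obtain h where h: "\<And>b. smooth_on UNIV (h b)" "\<And>b. h b c = frechet_derivative F (at c) b"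
      "\<And>z. F z = F c + (\<Sum>b\<in>Basis. (z \<bullet> b - c \<bullet> b) * h b z)"
      using hadamard[OF F] by blast
    have near_y: "dist a c < e / 2" using near y(2) by (simp add: c_def)
    have "(f \<circ> inv_into U \<phi> has_derivative frechet_derivative F (at c)) (at c)"
    proof (rule has_derivative_transform_within_open)
      show "(F has_derivative frechet_derivative F (at c)) (at c)"
        using smooth_on_has_derivative[OF open_UNIV F] by simp
      show "open (ball a (e / 2))" "c \<in> ball a (e / 2)" using near_y by auto
      show "F z = (f \<circ> inv_into U \<phi>) z" if "z \<in> ball a (e / 2)" for z
        using that by (simp add: F_def \<rho>(2))
    qed
    then have hD: "h b c = D b f c" for b
      using frechet_derivative_at by (metis D_def h(2))
    define H where "H b = pull (\<lambda>z. \<rho> z * h b z)" for b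
    have H: "H b \<in> smooth_fun M" for b
      unfolding H_def by (intro pull \<rho> h)
    have \<xi>y: "\<xi> b y = c \<bullet> b" and Hy: "H b y = D b f c" for b
      using near_y y(1) \<rho>(2)[of c] by (simp_all add: \<xi>_def H_def pull_def hD flip: c_def)
    \<comment> \<open>The Hadamard expansion of \<open>f\<close> about \<open>y\<close> rebuilt from
      global smooth functions: where \<open>\<rho> = 1\<close>, \<open>\<xi> b\<close> is a
      coordinate and \<open>H b\<close> is \<open>h b\<close>.\<close>
    define T where "T z = f y + (\<Sum>b\<in>Basis. (\<xi> b z + (- (c \<bullet> b))) * H b z)" for z
    have sm: "(\<lambda>z. \<xi> b z + (- (c \<bullet> b))) \<in> smooth_fun M" for b
      by (intro smooth_fun_add smooth_fun_const \<xi> M)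
    have sm2: "(\<lambda>z. (\<xi> b z + (- (c \<bullet> b))) * H b z) \<in> smooth_fun M" for b
      by (intro smooth_fun_mult H sm M)
    have T: "T \<in> smooth_fun M"
      unfolding T_def by (intro smooth_fun_add smooth_fun_const smooth_fun_sum sm2 M)
    \<comment> \<open>This stands in for the locality of derivations: applying \<open>v\<close> to
      both sides and using \<open>T y = f y\<close>, the terms with \<open>v \<psi>\<close> cancel
      and \<open>v f = v T\<close> follows up to the nonzero factor \<open>\<psi> y\<close>.\<close>
    have "\<psi> z * f z = \<psi> z * T z" for z
    proof (cases "\<psi> z = 0")
      case False
      then have z: "z \<in> U" "\<rho>' (\<phi> z) \<noteq> 0"
        by (auto simp: \<psi>_def pull_def split: if_splits)
      then have r: "\<rho> (\<phi> z) = 1" using near \<rho>(2) less_imp_le by blast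
      have rc: "\<rho> c = 1" using near_y \<rho>(2) less_imp_le by blast
      have "f z = F (\<phi> z)" by (simp add: F_def r inv z(1))
      moreover have "F c = f y" by (simp add: F_def rc inv y(1) c_def[symmetric]) (simp add: c_def inv y(1))
      ultimately have "f z = T z"
        using h(3)[of "\<phi> z"] by (simp add: T_def \<xi>_def H_def pull_def z(1) r)
      then show ?thesis by simp
    qed simp
    then have "(\<lambda>z. \<psi> z * f z) = (\<lambda>z. \<psi> z * T z)" by (intro ext)
    then have "v (\<lambda>z. \<psi> z * f z) = v (\<lambda>z. \<psi> z * T z)" by (rule arg_cong)
    then have "v \<psi> * f y + \<psi> y * v f = v \<psi> * T y + \<psi> y * v T"
      by (simp only: tangent_mult[OF v \<psi> f] tangent_mult[OF v \<psi> T])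
    moreover have "T y = f y" by (simp add: T_def \<xi>y)
    ultimately have "\<psi> y * v f = \<psi> y * v T" by simp
    moreover have "v T = (\<Sum>b\<in>Basis. v (\<xi> b) * D b f c)"
    proof -
      have "v T = v (\<lambda>z. f y) + (\<Sum>b\<in>Basis. v (\<lambda>z. (\<xi> b z + (- (c \<bullet> b))) * H b z))"
        unfolding T_def
        by (simp only: tangent_add[OF v smooth_fun_const[OF M] smooth_fun_sum[OF M sm2]]
            tangent_sum[OF M v sm2])
      moreover have "v (\<lambda>z. (\<xi> b z + (- (c \<bullet> b))) * H b z) = v (\<xi> b) * D b f c" for b
        by (simp only: tangent_mult[OF v sm H] tangent_add[OF v \<xi> smooth_fun_const[OF M]]
            tangent_const[OF M v] \<xi>y Hy) simp
      ultimately show ?thesis by (simp add: tangent_const[OF M v])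
    qed
    moreover have "E b y f = \<psi> y * D b f c" for b
      using f y(1) by (simp add: E_def \<psi>_def pull_def c_def)
    ultimately show ?thesis by (simp add: sum_distrib_left mult_ac)
  qed
  show thesis
    by (rule that[of \<xi> E \<psi>]) (use \<xi> E \<psi> \<psi>x main in \<open>simp add: local_frame_def\<close>)
qed

section \<open>Vector fields and Lie derivatives\<close>

lemma linear_on_add:
  "\<lbrakk>linear_on V \<alpha>; v \<in> V; w \<in> V\<rbrakk> \<Longrightarrow> \<alpha> (\<lambda>a. v a + w a) = \<alpha> v + \<alpha> w"
  unfolding linear_on_def plus_fun_def by blast

lemma linear_on_scale:
  "\<lbrakk>linear_on V \<alpha>; v \<in> V\<rbrakk> \<Longrightarrow> \<alpha> (\<lambda>a. c * v a) = c * \<alpha> v"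
  unfolding linear_on_def by blast

lemma linear_onI:
  assumes "\<And>v w. \<lbrakk>v \<in> V; w \<in> V\<rbrakk> \<Longrightarrow> \<alpha> (\<lambda>a. v a + w a) = \<alpha> v + \<alpha> w"
    and "\<And>v c. v \<in> V \<Longrightarrow> \<alpha> (\<lambda>a. c * v a) = c * \<alpha> v"
  shows "linear_on V \<alpha>"
  using assms unfolding linear_on_def plus_fun_def by blast

lemma linear_on_tangent_diff:
  assumes "linear_on (tangent_space M x) \<alpha>" "v \<in> tangent_space M x" "w \<in> tangent_space M x"
  shows "\<alpha> (\<lambda>f. v f - w f) = \<alpha> v - \<alpha> w"
  using linear_on_add[OF assms(1) tangent_space_diff[OF assms(2,3)] assms(3)] by simp

lemma linear_on_tangent_sum:
  assumes "linear_on (tangent_space M x) \<alpha>" "\<And>i. i \<in> I \<Longrightarrow> v i \<in> tangent_space M x"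
  shows "\<alpha> (\<lambda>f. \<Sum>i\<in>I. c i * v i f) = (\<Sum>i\<in>I. c i * \<alpha> (v i))"
  using assms(2)
proof (induction I rule: infinite_finite_induct)
  case (insert i I)
  have "\<alpha> (\<lambda>f. c i * v i f + (\<Sum>i\<in>I. c i * v i f))
      = \<alpha> (\<lambda>f. c i * v i f) + \<alpha> (\<lambda>f. \<Sum>i\<in>I. c i * v i f)"
    using insert.prems by (intro linear_on_add[OF assms(1)] tangent_space_scale tangent_space_sum) auto
  then show ?case
    using insert by (simp add: linear_on_scale[OF assms(1)])
qed (use linear_on_scale[OF assms(1) tangent_space_zero, of 0] in auto)

lemma dual_space_linear: "\<alpha> \<in> dual_space V \<Longrightarrow> linear_on V \<alpha>"
  unfolding dual_space_def by blast

lemma one_forms_linear: "\<beta> \<in> one_forms M \<Longrightarrow> linear_on (tangent_space M x) (\<beta> x)"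
  unfolding one_forms_def dual_space_def by blast

lemma one_forms_smooth:
  "\<lbrakk>\<beta> \<in> one_forms M; w \<in> vector_fields M\<rbrakk> \<Longrightarrow> (\<lambda>x. \<beta> x (w x)) \<in> smooth_fun M"
  unfolding one_forms_def by blast

lemma local_frame_expand:
  assumes "local_frame M x \<xi> E \<psi>" "v \<in> tangent_space M x"
  shows "v = (\<lambda>f. \<Sum>b\<in>Basis. v (\<xi> b) * E b x f)"
  by (rule ext) (rule local_frameD(5)[OF assms, unfolded local_frameD(4)[OF assms(1)] mult_1])

lemma vector_fields_add:
  assumes "smooth_atlas M" "u \<in> vector_fields M" "w \<in> vector_fields M"
  shows "(\<lambda>x f. u x f + w x f) \<in> vector_fields M"
  using vector_fieldsD[OF assms(2)] vector_fieldsD[OF assms(3)]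
  by (intro vector_fieldsI tangent_space_add smooth_fun_add assms(1)) auto

lemma vector_fields_scale:
  assumes "smooth_atlas M" "h \<in> smooth_fun M" "u \<in> vector_fields M"
  shows "(\<lambda>x f. h x * u x f) \<in> vector_fields M"
  using vector_fieldsD[OF assms(3)]
  by (intro vector_fieldsI tangent_space_scale smooth_fun_mult assms(1,2)) auto

lemma vector_fields_sum:
  assumes "smooth_atlas M" "\<And>i. i \<in> I \<Longrightarrow> h i \<in> smooth_fun M" "\<And>i. i \<in> I \<Longrightarrow> w i \<in> vector_fields M"
  shows "(\<lambda>x f. \<Sum>i\<in>I. h i x * w i x f) \<in> vector_fields M"
  by (intro vector_fieldsI tangent_space_sum smooth_fun_sum smooth_fun_mult assms(1,2)
      vector_fieldsD[OF assms(3)])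

text \<open>Constant coefficients over a frame of global fields. Conditions on a one-form that are
  stated for vector fields thereby determine it on each tangent vector.\<close>

lemma vector_field_extension:
  fixes M :: "('m::{second_countable_topology,t2_space}, 'e::euclidean_space) atlas"
  assumes M: "smooth_atlas M" and v: "v \<in> tangent_space M x"
  obtains w where "w \<in> vector_fields M" "w x = v"
proof -
  obtain \<xi> E \<psi> where fr: "local_frame M x \<xi> E \<psi>"
    using local_frame_exists[OF M] .
  show thesis
  proof (rule that)
    show "(\<lambda>y f. \<Sum>b\<in>Basis. v (\<xi> b) * E b y f) \<in> vector_fields M"
      using vector_fields_sum[OF M smooth_fun_const[OF M] local_frameD(2)[OF fr]] .
    show "(\<lambda>f. \<Sum>b\<in>Basis. v (\<xi> b) * E b x f) = v"
      using local_frame_expand[OF fr v] by (rule sym)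
  qed
qed

section \<open>The Jacobi-Lie bracket and its product rules\<close>

lemma jacobi_lie_vector_fields:
  assumes M: "smooth_atlas M" and u: "u \<in> vector_fields M" and w: "w \<in> vector_fields M"
  shows "jacobi_lie u w \<in> vector_fields M"
proof (rule vector_fieldsI)
  note uD = vector_fieldsD[OF u] and wD = vector_fieldsD[OF w]
  fix x
  show "jacobi_lie u w x \<in> tangent_space M x"
  proof (rule tangentI)
    fix f g assume fg: "f \<in> smooth_fun M" "g \<in> smooth_fun M"
    show "jacobi_lie u w x (\<lambda>y. f y + g y) = jacobi_lie u w x f + jacobi_lie u w x g"
      by (simp add: jacobi_lie_def tangent_add[OF uD(1)] tangent_add[OF wD(1)] fg uD(2) wD(2))
    show "jacobi_lie u w x (\<lambda>y. f y * g y) = jacobi_lie u w x f * g x + f x * jacobi_lie u w x g"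
      by (simp add: jacobi_lie_def tangent_add[OF uD(1)] tangent_add[OF wD(1)]
          tangent_mult[OF uD(1)] tangent_mult[OF wD(1)] fg uD(2) wD(2) smooth_fun_mult[OF M])
        (simp add: algebra_simps)
  next
    fix f c assume f: "f \<in> smooth_fun M"
    show "jacobi_lie u w x (\<lambda>y. c * f y) = c * jacobi_lie u w x f"
      by (simp add: jacobi_lie_def tangent_scale[OF uD(1)] tangent_scale[OF wD(1)] f uD(2) wD(2)
          right_diff_distrib)
  next
    \<comment> \<open>Each inner function is constantly 0, and derivations kill constants.\<close>
    fix f assume f: "f \<notin> smooth_fun M"
    show "jacobi_lie u w x f = 0"
      by (simp add: jacobi_lie_def tangent_nonsmooth[OF uD(1) f] tangent_nonsmooth[OF wD(1) f]
          tangent_const[OF M uD(1)] tangent_const[OF M wD(1)])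
  qed
next
  fix f assume f: "f \<in> smooth_fun M"
  have "(\<lambda>x. u x (\<lambda>y. w y f) + (-1) * w x (\<lambda>y. u y f)) \<in> smooth_fun M"
    using vector_fieldsD[OF u] vector_fieldsD[OF w] f
    by (intro smooth_fun_add smooth_fun_mult smooth_fun_const M) auto
  then show "(\<lambda>x. jacobi_lie u w x f) \<in> smooth_fun M"
    by (simp add: jacobi_lie_def)
qed

lemma jacobi_lie_scale_right:
  assumes M: "smooth_atlas M" and u: "u \<in> vector_fields M" and w: "w \<in> vector_fields M"
    and h: "h \<in> smooth_fun M"
  shows "jacobi_lie u (\<lambda>x f. h x * w x f) x = (\<lambda>f. h x * jacobi_lie u w x f + u x h * w x f)"
proof
  fix f
  note uD = vector_fieldsD[OF u] and wD = vector_fieldsD[OF w]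
  show "jacobi_lie u (\<lambda>x f. h x * w x f) x f = h x * jacobi_lie u w x f + u x h * w x f"
  proof (cases "f \<in> smooth_fun M")
    case True
    then show ?thesis
      using uD wD h by (simp add: jacobi_lie_def tangent_mult[OF uD(1)] algebra_simps)
  next
    case False
    then show ?thesis
      by (simp add: jacobi_lie_def tangent_nonsmooth[OF uD(1)] tangent_nonsmooth[OF wD(1)]
          tangent_const[OF M uD(1)] tangent_const[OF M wD(1)])
  qed
qed

lemma jacobi_lie_scale_left:
  assumes M: "smooth_atlas M" and u: "u \<in> vector_fields M" and w: "w \<in> vector_fields M"
    and h: "h \<in> smooth_fun M"
  shows "jacobi_lie (\<lambda>x f. h x * u x f) w x = (\<lambda>f. h x * jacobi_lie u w x f - w x h * u x f)"
proof
  fix f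
  have "jacobi_lie (\<lambda>x f. h x * u x f) w x f = - jacobi_lie w (\<lambda>x f. h x * u x f) x f"
    by (simp add: jacobi_lie_def)
  also have "\<dots> = h x * jacobi_lie u w x f - w x h * u x f"
    unfolding jacobi_lie_scale_right[OF M w u h] by (simp add: jacobi_lie_def algebra_simps)
  finally show "jacobi_lie (\<lambda>x f. h x * u x f) w x f = h x * jacobi_lie u w x f - w x h * u x f" .
qed

lemma jacobi_lie_add_right:
  assumes M: "smooth_atlas M" and u: "u \<in> vector_fields M" and w: "w \<in> vector_fields M"
    and w': "w' \<in> vector_fields M"
  shows "jacobi_lie u (\<lambda>x f. w x f + w' x f) x = (\<lambda>f. jacobi_lie u w x f + jacobi_lie u w' x f)"
proof
  fix f
  note uD = vector_fieldsD[OF u] and wD = vector_fieldsD[OF w] and wD' = vector_fieldsD[OF w']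
  show "jacobi_lie u (\<lambda>x f. w x f + w' x f) x f = jacobi_lie u w x f + jacobi_lie u w' x f"
  proof (cases "f \<in> smooth_fun M")
    case True
    then show ?thesis
      using uD wD wD' by (simp add: jacobi_lie_def tangent_add[OF uD(1)])
  next
    case False
    then show ?thesis
      by (simp add: jacobi_lie_def tangent_nonsmooth[OF uD(1)] tangent_nonsmooth[OF wD(1)]
          tangent_nonsmooth[OF wD'(1)] tangent_const[OF M uD(1)] tangent_const[OF M wD(1)]
          tangent_const[OF M wD'(1)])
  qed
qed

text \<open>The defining formula is linear over smooth functions in \<open>w\<close>, hence sees
  only the value \<open>w x\<close>. Extending tangent vectors to fields therefore gives a one-form.
  It is the only one, since every tangent vector extends and all other arguments give 0.\<close>

lemma lie_derivative:
  fixes M :: "('m::{second_countable_topology,t2_space}, 'e::euclidean_space) atlas"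
  assumes M: "smooth_atlas M" and u: "u \<in> vector_fields M" and \<beta>: "\<beta> \<in> one_forms M"
  shows "lie_derivative M u \<beta> \<in> one_forms M"
    and "w \<in> vector_fields M \<Longrightarrow>
      lie_derivative M u \<beta> x (w x) = u x (\<lambda>y. \<beta> y (w y)) - \<beta> x (jacobi_lie u w x)"
proof -
  define R where "R w x = u x (\<lambda>y. \<beta> y (w y)) - \<beta> x (jacobi_lie u w x)" for w x
  define P where "P \<gamma> \<longleftrightarrow> \<gamma> \<in> one_forms M \<and>
     (\<forall>w\<in>vector_fields M. \<forall>x. \<gamma> x (w x) = R w x)" for \<gamma>
  note uD = vector_fieldsD[OF u]
  note lin = one_forms_linear[OF \<beta>] and sm = one_forms_smooth[OF \<beta>]
  note jl = vector_fieldsD[OF jacobi_lie_vector_fields[OF M u]]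
  have R_smooth: "R w \<in> smooth_fun M" if w: "w \<in> vector_fields M" for w
  proof -
    have "(\<lambda>x. u x (\<lambda>y. \<beta> y (w y)) + (-1) * \<beta> x (jacobi_lie u w x)) \<in> smooth_fun M"
      by (intro smooth_fun_add smooth_fun_mult smooth_fun_const M uD sm w jacobi_lie_vector_fields u)
    then show ?thesis by (simp add: R_def[abs_def])
  qed
  have R_add: "R (\<lambda>y f. w y f + w' y f) x = R w x + R w' x"
    if w: "w \<in> vector_fields M" "w' \<in> vector_fields M" for w w' x
    unfolding R_def jacobi_lie_add_right[OF M u w]
    using vector_fieldsD(1)[OF w(1)] vector_fieldsD(1)[OF w(2)]
    by (simp add: linear_on_add[OF lin] jl(1) w tangent_add[OF uD(1) sm[OF w(1)] sm[OF w(2)]])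
  \<comment> \<open>The terms containing \<open>u x h\<close>, one from the Leibniz rule and one
    from the bracket, cancel.\<close>
  have R_scale: "R (\<lambda>y f. h y * w y f) x = h x * R w x"
    if w: "w \<in> vector_fields M" and h: "h \<in> smooth_fun M" for w h x
  proof -
    note wD = vector_fieldsD(1)[OF w]
    show ?thesis
      unfolding R_def jacobi_lie_scale_right[OF M u w h]
      by (simp add: linear_on_add[OF lin] linear_on_scale[OF lin] jl(1)[OF w] wD tangent_space_scale
          tangent_mult[OF uD(1) h sm[OF w]] algebra_simps)
  qed
  have R_zero: "R (\<lambda>y f. 0) x = 0" for x
    using R_scale[OF u smooth_fun_const[OF M, of 0], of x] by simp
  have R_sum: "R (\<lambda>y f. \<Sum>i\<in>I. h i y * E i y f) x = (\<Sum>i\<in>I. h i x * R (E i) x)"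
    if "finite I" "\<And>i. h i \<in> smooth_fun M" "\<And>i. E i \<in> vector_fields M" for I :: "'e set" and h E x
    using that(1)
  proof (induction I)
    case (insert i I)
    have "R (\<lambda>y f. h i y * E i y f + (\<Sum>i\<in>I. h i y * E i y f)) x
        = R (\<lambda>y f. h i y * E i y f) x + R (\<lambda>y f. \<Sum>i\<in>I. h i y * E i y f) x"
      by (rule R_add[OF vector_fields_scale[OF M] vector_fields_sum[OF M]]) (use that in auto)
    then show ?case using insert that by (simp add: R_scale)
  qed (simp add: R_zero)
  have R_point: "R w x = R w' x"
    if w: "w \<in> vector_fields M" "w' \<in> vector_fields M" "w x = w' x" for w w' x
  proof -
    obtain \<xi> E \<psi> where fr: "local_frame M x \<xi> E \<psi>"
    using local_frame_exists[OF M] .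
  note fr = local_frameD[OF fr]
    \<comment> \<open>Multiplying \<open>w\<close> by \<open>\<psi>\<close> does not change
      \<open>R w x\<close>, as \<open>\<psi> x = 1\<close>, and turns it into a combination of the
      frame as a field, so that linearity over smooth functions leaves only the coefficients at
      \<open>x\<close>.\<close>
    have "R w x = (\<Sum>b\<in>Basis. w x (\<xi> b) * R (E b) x)" if w: "w \<in> vector_fields M" for w
    proof -
      note wD = vector_fieldsD[OF w]
      have "R w x = R (\<lambda>y f. \<psi> y * w y f) x" using R_scale[OF w fr(3)] fr(4) by simp
      also have "\<dots> = R (\<lambda>y f. \<Sum>b\<in>Basis. w y (\<xi> b) * E b y f) x"
        by (simp add: fr(5)[OF wD(1)])
      also have "\<dots> = (\<Sum>b\<in>Basis. w x (\<xi> b) * R (E b) x)"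
        by (rule R_sum[where h = "\<lambda>b y. w y (\<xi> b)"]) (use wD fr in auto)
      finally show ?thesis .
    qed
    then show ?thesis using w by simp
  qed
  \<comment> \<open>\<open>R_point\<close> makes the choice of the extending field
    irrelevant.\<close>
  define \<gamma> where "\<gamma> x v = (if v \<in> tangent_space M x
      then R (SOME w. w \<in> vector_fields M \<and> w x = v) x else 0)" for x v
  have \<gamma>: "\<gamma> x (w x) = R w x" if w: "w \<in> vector_fields M" for w x
  proof -
    define w' where "w' = (SOME w'. w' \<in> vector_fields M \<and> w' x = w x)"
    have "w' \<in> vector_fields M \<and> w' x = w x"
      unfolding w'_def by (rule someI[of _ w]) (use w in simp)
    then show ?thesis
      using R_point[of w' w x] w vector_fieldsD(1)[OF w] by (simp add: \<gamma>_def w'_def)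
  qed
  have "\<gamma> x \<in> dual_space (tangent_space M x)" for x
  proof -
    have "linear_on (tangent_space M x) (\<gamma> x)"
    proof (rule linear_onI)
      fix v v' assume v: "v \<in> tangent_space M x" "v' \<in> tangent_space M x"
      obtain w where w: "w \<in> vector_fields M" "w x = v" using vector_field_extension[OF M v(1)] .
      obtain w' where w': "w' \<in> vector_fields M" "w' x = v'" using vector_field_extension[OF M v(2)] .
      show "\<gamma> x (\<lambda>f. v f + v' f) = \<gamma> x v + \<gamma> x v'"
        using \<gamma>[OF vector_fields_add[OF M w(1) w'(1)], of x] \<gamma>[OF w(1), of x] \<gamma>[OF w'(1), of x]
          R_add[OF w(1) w'(1)] w(2) w'(2) by simp
    next
      fix v c assume v: "v \<in> tangent_space M x"
      obtain w where w: "w \<in> vector_fields M" "w x = v" using vector_field_extension[OF M v] .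
      show "\<gamma> x (\<lambda>f. c * v f) = c * \<gamma> x v"
        using \<gamma>[OF vector_fields_scale[OF M smooth_fun_const[OF M] w(1)], of x c] \<gamma>[OF w(1), of x]
          R_scale[OF w(1) smooth_fun_const[OF M]] w(2) by simp
    qed
    then show ?thesis by (auto simp: dual_space_def \<gamma>_def)
  qed
  then have "P \<gamma>"
    unfolding P_def one_forms_def using \<gamma> R_smooth by auto
  moreover have "\<gamma>' = \<gamma>" if "P \<gamma>'" for \<gamma>'
  proof (intro ext)
    fix x v
    show "\<gamma>' x v = \<gamma> x v"
    proof (cases "v \<in> tangent_space M x")
      case True
      obtain w where "w \<in> vector_fields M" "w x = v" using vector_field_extension[OF M True] .
      then show ?thesis using that \<open>P \<gamma>\<close> unfolding P_def by metis
    next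
      case False
      then show ?thesis
        using that \<open>P \<gamma>\<close> by (simp add: P_def one_forms_def dual_space_def)
    qed
  qed
  ultimately have "P (THE \<gamma>. P \<gamma>)" by (rule theI)
  moreover have "lie_derivative M u \<beta> = (THE \<gamma>. P \<gamma>)"
    unfolding lie_derivative_def P_def R_def ..
  ultimately have "P (lie_derivative M u \<beta>)" by simp
  then show "lie_derivative M u \<beta> \<in> one_forms M"
    and "w \<in> vector_fields M \<Longrightarrow>
      lie_derivative M u \<beta> x (w x) = u x (\<lambda>y. \<beta> y (w y)) - \<beta> x (jacobi_lie u w x)"
    unfolding P_def R_def by auto
qed

section \<open>Divergence\<close>

text \<open>Antisymmetrizing \<open>df \<otimes> \<mu>\<close> in its \<open>n + 1\<close> arguments gives \<open>0\<close>, because \<open>T\<^sub>xM\<close> is spanned by \<open>n\<close>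
  vectors: either the \<open>E\<^sub>b\<close> span it, and one may take \<open>v\<close> among them, or they are dependent.\<close>

lemma top_form_exchange:
  fixes M :: "('m::{second_countable_topology,t2_space}, 'e::euclidean_space) atlas"
    and E :: "'e \<Rightarrow> 'm tangent"
  assumes M: "smooth_atlas M" and \<mu>: "top_form M \<mu>"
    and E: "\<And>b. b \<in> Basis \<Longrightarrow> E b \<in> tangent_space M x" and v: "v \<in> tangent_space M x"
  shows "(\<Sum>b\<in>Basis. E b f * \<mu> x (E(b := v))) = v f * \<mu> x E"
proof -
  let ?T = "tangent_space M x"
  have lin: "linear_on ?T (\<lambda>v. \<mu> x (E(b := v)))"
    if "\<And>b. b \<in> Basis \<Longrightarrow> E b \<in> ?T" "b \<in> Basis" for E b
    using \<mu> that unfolding top_form_def by blast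
  have alt: "\<mu> x E = 0"
    if "\<And>b. b \<in> Basis \<Longrightarrow> E b \<in> ?T" "b \<in> Basis" "c \<in> Basis" "b \<noteq> c" "E b = E c" for E b c
    using \<mu> that unfolding top_form_def by blast
  have antisym: "\<mu> x (E(b := v, c := w)) = - \<mu> x (E(b := w, c := v))"
    if E: "\<And>b. b \<in> Basis \<Longrightarrow> E b \<in> ?T" and bc: "b \<in> Basis" "c \<in> Basis" "b \<noteq> c"
      and vw: "v \<in> ?T" "w \<in> ?T" for E b c v w
  proof -
    define A where "A v w = \<mu> x (E(b := v, c := w))" for v w
    \<comment> \<open>\<open>lin\<close> concerns the outermost update; linearity in the slot
      \<open>b\<close> is read off after exchanging the two updates.\<close>
    have A_swap: "A v w = \<mu> x (E(c := w, b := v))" for v w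
      using bc(3) by (simp add: A_def fun_upd_twist)
    have 0: "A v v = 0" if "v \<in> ?T" for v
      unfolding A_def using E that bc by (intro alt[of _ b c]) auto
    have r: "A s (\<lambda>f. v f + w f) = A s v + A s w" if "s \<in> ?T" for s
      unfolding A_def by (rule linear_on_add[OF lin]) (use E that vw bc in auto)
    have l: "A (\<lambda>f. v f + w f) s = A v s + A w s" if "s \<in> ?T" for s
      unfolding A_swap by (rule linear_on_add[OF lin]) (use E that vw bc in auto)
    have vw': "(\<lambda>f. v f + w f) \<in> ?T" using vw by (rule tangent_space_add)
    have "A v w + A w v = 0"
      using 0[OF vw'] 0[OF vw(1)] 0[OF vw(2)] r[OF vw'] l[OF vw(1)] l[OF vw(2)] by simp
    then show ?thesis by (simp add: A_def)
  qed
  obtain \<xi> Z \<psi> where "local_frame M x \<xi> Z \<psi>"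
    using local_frame_exists[OF M] .
  note fr = local_frame_expand[OF this]
  have eqI: "v = w" if "v \<in> ?T" "w \<in> ?T" "\<And>b. b \<in> Basis \<Longrightarrow> v (\<xi> b) = w (\<xi> b)" for v w
    using fr[OF that(1)] fr[OF that(2)] that(3) by simp
  \<comment> \<open>The matrix whose column \<open>c\<close> holds the frame coordinates of
    \<open>E c\<close>. It is square, since \<open>E\<close> is indexed by the basis of the model
    space: injectivity makes the family spanning, and a kernel vector is a linear relation.\<close>
  define A where "A z = (\<Sum>c\<in>Basis. (z \<bullet> c) *\<^sub>R (\<Sum>b\<in>Basis. E c (\<xi> b) *\<^sub>R b))" for z :: 'e
  have A: "A z \<bullet> b = (\<Sum>c\<in>Basis. (z \<bullet> c) * E c (\<xi> b))" if "b \<in> Basis" for z b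
    using that by (simp add: A_def inner_sum_left inner_Basis if_distrib sum.delta' cong: if_cong)
  have "linear A"
    unfolding A_def by (intro linearI) (simp_all add: inner_add_left algebra_simps sum.distrib
        scaleR_sum_right)
  have comb: "(\<lambda>f. \<Sum>c\<in>C. k c * E c f) \<in> ?T" if "C \<subseteq> Basis" for C k
    using that E by (intro tangent_space_sum) auto
  show ?thesis
  proof (cases "inj A")
    case True
    then have "surj A" using \<open>linear A\<close> linear_injective_imp_surjective by blast
    then obtain z where z: "A z = (\<Sum>b\<in>Basis. v (\<xi> b) *\<^sub>R b)" by (metis surjD)
    have "v (\<xi> b) = (\<Sum>c\<in>Basis. (z \<bullet> c) * E c (\<xi> b))" if "b \<in> Basis" for b
      using that A[OF that, of z] z by simp
    then have v_eq: "v = (\<lambda>f. \<Sum>c\<in>Basis. (z \<bullet> c) * E c f)"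
      by (intro eqI v comb) auto
    \<comment> \<open>For \<open>b \<noteq> c\<close> the update repeats the argument
      \<open>E c\<close>, so only \<open>b = c\<close> survives: the claim for
      \<open>v = E c\<close>.\<close>
    have E_c: "(\<Sum>b\<in>Basis. E b f * \<mu> x (E(b := E c))) = E c f * \<mu> x E" if "c \<in> Basis" for c
    proof -
      have "E b f * \<mu> x (E(b := E c)) = (if b = c then E c f * \<mu> x E else 0)" if "b \<in> Basis" for b
        using that \<open>c \<in> Basis\<close> E alt[of "E(b := E c)" b c] by auto
      then show ?thesis using that by (simp add: sum.delta')
    qed
    have "(\<Sum>b\<in>Basis. E b f * \<mu> x (E(b := v)))
        = (\<Sum>b\<in>Basis. E b f * (\<Sum>c\<in>Basis. (z \<bullet> c) * \<mu> x (E(b := E c))))"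
    proof (rule sum.cong)
      fix b :: 'e assume b: "b \<in> Basis"
      show "E b f * \<mu> x (E(b := v)) = E b f * (\<Sum>c\<in>Basis. (z \<bullet> c) * \<mu> x (E(b := E c)))"
        by (subst v_eq, subst linear_on_tangent_sum[OF lin[OF E b]]) (use E in auto)
    qed simp
    also have "\<dots> = (\<Sum>c\<in>Basis. (z \<bullet> c) * (\<Sum>b\<in>Basis. E b f * \<mu> x (E(b := E c))))"
      by (simp add: sum_distrib_left mult_ac) (rule sum.swap)
    also have "\<dots> = (\<Sum>c\<in>Basis. (z \<bullet> c) * E c f) * \<mu> x E"
      by (simp add: E_c sum_distrib_left sum_distrib_right mult_ac)
    also have "\<dots> = v f * \<mu> x E" by (subst v_eq) simp
    finally show ?thesis .
  next
    case False
    then obtain z where z: "A z = 0" "z \<noteq> 0"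
      using \<open>linear A\<close> linear_injective_0 by blast
    then obtain b0 where b0: "b0 \<in> Basis" "z \<bullet> b0 \<noteq> 0"
      using euclidean_all_zero_iff by blast
    let ?C = "Basis - {b0}"
    \<comment> \<open>The relation given by the kernel vector \<open>z\<close>, solved for
      \<open>E b0\<close>.\<close>
    define k where "k c = - (z \<bullet> c) / (z \<bullet> b0)" for c
    have "E b0 = (\<lambda>f. \<Sum>c\<in>?C. k c * E c f)"
    proof (intro eqI comb E b0(1))
      fix b :: 'e assume b: "b \<in> Basis"
      have "0 = (\<Sum>c\<in>Basis. (z \<bullet> c) * E c (\<xi> b))" using A[OF b, of z] z(1) by simp
      also have "\<dots> = (z \<bullet> b0) * E b0 (\<xi> b) + (\<Sum>c\<in>?C. (z \<bullet> c) * E c (\<xi> b))"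
        using b0(1) by (simp add: sum.remove)
      finally have "E b0 (\<xi> b) = - (\<Sum>c\<in>?C. (z \<bullet> c) * E c (\<xi> b)) / (z \<bullet> b0)"
        using b0(2) by (simp add: field_simps)
      then show "E b0 (\<xi> b) = (\<Sum>c\<in>?C. k c * E c (\<xi> b))"
        by (simp add: k_def sum_divide_distrib sum_negf)
    qed auto
    \<comment> \<open>The difference of the two sides with the entry \<open>E b0\<close> replaced by
      a variable \<open>w\<close>. It is linear in \<open>w\<close> and vanishes at the other
      \<open>E c\<close>: the summand \<open>b = c\<close> cancels the first term by antisymmetry,
      and the rest contain \<open>E c\<close> twice. Hence it vanishes at their combination
      \<open>E b0\<close>.\<close>
    define \<Psi> where "\<Psi> w = w f * \<mu> x (E(b0 := v))
      + (\<Sum>b\<in>?C. E b f * \<mu> x (E(b := v, b0 := w))) - v f * \<mu> x (E(b0 := w))" for w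
    have lin1: "linear_on ?T (\<lambda>w. \<mu> x (E(b := v, b0 := w)))" for b
      using E v b0 by (intro lin) auto
    note lin2 = lin[OF E b0(1)]
    have "linear_on ?T \<Psi>"
    proof (rule linear_onI)
      fix s t assume st: "s \<in> ?T" "t \<in> ?T"
      show "\<Psi> (\<lambda>f. s f + t f) = \<Psi> s + \<Psi> t"
        by (simp add: \<Psi>_def linear_on_add[OF lin1 st] linear_on_add[OF lin2 st] algebra_simps
            sum.distrib)
    next
      fix s c assume s: "s \<in> ?T"
      show "\<Psi> (\<lambda>f. c * s f) = c * \<Psi> s"
        by (simp add: \<Psi>_def linear_on_scale[OF lin1 s] linear_on_scale[OF lin2 s] algebra_simps
            sum_distrib_left)
    qed
    have \<Psi>_E: "\<Psi> (E c) = 0" if c: "c \<in> ?C" for c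
    proof -
      have "\<mu> x (E(b0 := E c)) = 0"
        using c b0 E by (intro alt[of _ b0 c]) auto
      moreover have "(\<Sum>b\<in>?C. E b f * \<mu> x (E(b := v, b0 := E c)))
          = E c f * \<mu> x (E(c := v, b0 := E c))"
      proof -
        have "E b f * \<mu> x (E(b := v, b0 := E c))
            = (if b = c then E c f * \<mu> x (E(c := v, b0 := E c)) else 0)" if "b \<in> ?C" for b
        proof (cases "b = c")
          case False
          then have "\<mu> x (E(b := v, b0 := E c)) = 0"
            using that c b0 E v by (intro alt[of _ b0 c]) auto
          then show ?thesis using False by simp
        qed simp
        then have "(\<Sum>b\<in>?C. E b f * \<mu> x (E(b := v, b0 := E c)))
            = (\<Sum>b\<in>?C. if b = c then E c f * \<mu> x (E(c := v, b0 := E c)) else 0)"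
          by (rule sum.cong[OF refl])
        also have "\<dots> = E c f * \<mu> x (E(c := v, b0 := E c))"
          using c by (simp add: sum.delta')
        finally show ?thesis .
      qed
      moreover have "\<mu> x (E(c := v, b0 := E c)) = - \<mu> x (E(b0 := v))"
      proof -
        have "\<mu> x (E(c := v, b0 := E c)) = - \<mu> x (E(c := E c, b0 := v))"
          using c b0 E v by (intro antisym) auto
        then show ?thesis by simp
      qed
      ultimately show ?thesis by (simp add: \<Psi>_def)
    qed
    have "\<Psi> (E b0) = 0"
      by (subst \<open>E b0 = _\<close>, subst linear_on_tangent_sum[OF \<open>linear_on ?T \<Psi>\<close>])
        (use E \<Psi>_E in auto)
    moreover have "\<mu> x (E(b := v, b0 := E b0)) = \<mu> x (E(b := v))" if "b \<in> ?C" for b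
      using that by (metis DiffE fun_upd_triv fun_upd_twist insertI1)
    ultimately show ?thesis
      using b0(1) by (simp add: \<Psi>_def sum.remove)
  qed
qed

text \<open>By \<open>[f u, W] = f [u, W] - (W f) u\<close>, scaling by \<open>f\<close> adds the
  sum of the terms in which \<open>W b\<close> is replaced by \<open>u\<close>, weighted by the
  derivative of \<open>f\<close> along \<open>W b\<close>. \<open>top_form_exchange\<close>
  evaluates this sum to \<open>(u f) \<mu>\<close>.\<close>

lemma has_divergence_scale:
  fixes M :: "('m::{second_countable_topology,t2_space}, 'e::euclidean_space) atlas"
  assumes M: "smooth_atlas M" and \<mu>: "top_form M \<mu>" and u: "u \<in> vector_fields M"
    and div: "has_divergence M \<mu> u h" and f: "f \<in> smooth_fun M"
  shows "has_divergence M \<mu> (\<lambda>x a. f x * u x a) (\<lambda>x. f x * h x + u x f)"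
  unfolding has_divergence_def
proof (intro allI impI)
  fix W :: "'e \<Rightarrow> 'm vector_field" and x
  assume W: "\<forall>b\<in>Basis. W b \<in> vector_fields M"
  define E where "E b = W b x" for b
  have E: "E b \<in> tangent_space M x" if "b \<in> Basis" for b
    using W that vector_fieldsD(1)[of "W b" M x] by (auto simp: E_def)
  have jl: "jacobi_lie u (W b) x \<in> tangent_space M x" if "b \<in> Basis" for b
    using vector_fieldsD(1)[OF jacobi_lie_vector_fields[OF M u]] W that by blast
  have "\<mu> x (E(b := jacobi_lie (\<lambda>x a. f x * u x a) (W b) x))
      = f x * \<mu> x (E(b := jacobi_lie u (W b) x)) - E b f * \<mu> x (E(b := u x))" if b: "b \<in> Basis" for b
  proof -
    have lin: "linear_on (tangent_space M x) (\<lambda>v. \<mu> x (E(b := v)))"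
      using \<mu> E b unfolding top_form_def by blast
    have Wb: "W b \<in> vector_fields M" using W b by blast
    show ?thesis
      unfolding jacobi_lie_scale_left[OF M u Wb f]
      using linear_on_tangent_diff[OF lin tangent_space_scale[OF jl[OF b]]
          tangent_space_scale[OF vector_fieldsD(1)[OF u]], of "f x" "W b x f"]
      by (simp add: linear_on_scale[OF lin] jl b vector_fieldsD(1)[OF u] E_def)
  qed
  then have "(\<Sum>b\<in>Basis. \<mu> x (E(b := jacobi_lie (\<lambda>x a. f x * u x a) (W b) x)))
      = f x * (\<Sum>b\<in>Basis. \<mu> x (E(b := jacobi_lie u (W b) x)))
        - (\<Sum>b\<in>Basis. E b f * \<mu> x (E(b := u x)))"
    by (simp add: sum_subtractf sum_distrib_left)
  moreover have "(\<Sum>b\<in>Basis. E b f * \<mu> x (E(b := u x))) = u x f * \<mu> x E"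
    by (rule top_form_exchange[OF M \<mu> E vector_fieldsD(1)[OF u]])
  moreover have "u x (\<lambda>y. \<mu> y (\<lambda>b. W b y)) - (\<Sum>b\<in>Basis. \<mu> x (E(b := jacobi_lie u (W b) x)))
      = h x * \<mu> x E"
    using div W unfolding has_divergence_def E_def by blast
  ultimately show "f x * u x (\<lambda>y. \<mu> y (\<lambda>b. W b y))
      - (\<Sum>b\<in>Basis. \<mu> x ((\<lambda>c. W c x)(b := jacobi_lie (\<lambda>x a. f x * u x a) (W b) x)))
      = (f x * h x + u x f) * \<mu> x (\<lambda>b. W b x)"
    unfolding E_def[abs_def, symmetric] by (simp add: E_def[abs_def, symmetric]) (simp add: algebra_simps)
qed

section \<open>Differentials of maps into a Lie algebra and its dual\<close>

text \<open>The Leibniz rule at \<open>e\<close> has coefficients \<open>f e\<close> and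
  \<open>g e\<close> that do not depend on the point of \<open>M\<close>. It is thus a linear
  condition on \<open>\<theta> y\<close> and survives differentiation in \<open>y\<close>.\<close>

lemma diff_along_algebra_valued:
  assumes M: "smooth_atlas M" and \<theta>: "\<theta> \<in> algebra_valued M G e" and v: "v \<in> tangent_space M x"
  shows "diff_along \<theta> v \<in> tangent_space G e"
proof (rule tangentI)
  have \<theta>T: "\<theta> y \<in> tangent_space G e" for y
    using \<theta> unfolding algebra_valued_def by blast
  have sm: "f \<in> smooth_fun G \<Longrightarrow> (\<lambda>y. \<theta> y f) \<in> smooth_fun M" for f
    using \<theta> unfolding algebra_valued_def by blast
  have sc: "f \<in> smooth_fun G \<Longrightarrow> (\<lambda>y. c * \<theta> y f) \<in> smooth_fun M" for f c
    by (intro smooth_fun_mult smooth_fun_const M sm)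
  show "diff_along \<theta> v f = 0" if "f \<notin> smooth_fun G" for f
    unfolding diff_along_def by (simp add: tangent_nonsmooth[OF \<theta>T that] tangent_const[OF M v])
  show "diff_along \<theta> v (\<lambda>y. c * f y) = c * diff_along \<theta> v f" if "f \<in> smooth_fun G" for f c
    unfolding diff_along_def by (simp add: tangent_scale[OF \<theta>T that] tangent_scale[OF v sm[OF that]])
  fix f g assume f: "f \<in> smooth_fun G" and g: "g \<in> smooth_fun G"
  show "diff_along \<theta> v (\<lambda>y. f y + g y) = diff_along \<theta> v f + diff_along \<theta> v g"
    unfolding diff_along_def
    by (simp add: tangent_add[OF \<theta>T f g] tangent_add[OF v sm[OF f] sm[OF g]])
  have "v (\<lambda>y. g e * \<theta> y f + f e * \<theta> y g) = g e * v (\<lambda>y. \<theta> y f) + f e * v (\<lambda>y. \<theta> y g)"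
    by (simp add: tangent_add[OF v sc[OF f] sc[OF g]] tangent_scale[OF v] sm f g)
  then show "diff_along \<theta> v (\<lambda>y. f y * g y) = diff_along \<theta> v f * g e + f e * diff_along \<theta> v g"
    unfolding diff_along_def by (simp add: tangent_mult[OF \<theta>T f g] mult.commute)
qed

lemma diff_along_coalgebra_valued:
  assumes M: "smooth_atlas M" and \<sigma>: "\<sigma> \<in> coalgebra_valued M G e" and v: "v \<in> tangent_space M x"
  shows "diff_along \<sigma> v \<in> dual_space (tangent_space G e)"
proof -
  have lin: "linear_on (tangent_space G e) (\<sigma> y)" for y
    using \<sigma> unfolding coalgebra_valued_def dual_space_def by blast
  have sm: "\<xi> \<in> tangent_space G e \<Longrightarrow> (\<lambda>y. \<sigma> y \<xi>) \<in> smooth_fun M" for \<xi>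
    using \<sigma> unfolding coalgebra_valued_def by blast
  have "\<sigma> y \<xi> = 0" if "\<xi> \<notin> tangent_space G e" for y \<xi>
    using \<sigma> that unfolding coalgebra_valued_def dual_space_def by blast
  then have "diff_along \<sigma> v \<xi> = 0" if "\<xi> \<notin> tangent_space G e" for \<xi>
    using that by (simp add: diff_along_def tangent_const[OF M v])
  moreover have "linear_on (tangent_space G e) (diff_along \<sigma> v)"
    by (rule linear_onI) (simp_all add: diff_along_def linear_on_add[OF lin] linear_on_scale[OF lin]
        tangent_add[OF v] tangent_scale[OF v] sm)
  ultimately show ?thesis unfolding dual_space_def by blast
qed

text \<open>A derivation acts on scalar functions only, so the pairing is first written as a finite
  sum of products of scalar components, using a frame of \<open>G\<close> at \<open>e\<close>; each
  product obeys the Leibniz rule.\<close>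

lemma diff_along_pairing:
  fixes G :: "('g::{second_countable_topology,t2_space}, 'f::euclidean_space) atlas"
  assumes M: "smooth_atlas M" and G: "smooth_atlas G" and v: "v \<in> tangent_space M x"
    and \<sigma>: "\<sigma> \<in> coalgebra_valued M G e" and \<theta>: "\<theta> \<in> algebra_valued M G e"
  shows "v (\<lambda>y. \<sigma> y (\<theta> y)) = diff_along \<sigma> v (\<theta> x) + \<sigma> x (diff_along \<theta> v)"
proof -
  obtain \<xi> Z \<psi> where frame: "local_frame G e \<xi> Z \<psi>"
    using local_frame_exists[OF G] .
  note fr = local_frame_expand[OF frame]
  define E where "E b = Z b e" for b
  have \<xi>: "\<xi> b \<in> smooth_fun G" and E: "E b \<in> tangent_space G e" for b
    using local_frameD(1)[OF frame] vector_fieldsD(1)[OF local_frameD(2)[OF frame]]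
    by (simp_all add: E_def)
  have \<theta>T: "\<theta> y \<in> tangent_space G e" and \<theta>s: "(\<lambda>y. \<theta> y (\<xi> b)) \<in> smooth_fun M" for y b
    using \<theta> \<xi> unfolding algebra_valued_def by blast+
  have \<sigma>s: "(\<lambda>y. \<sigma> y (E b)) \<in> smooth_fun M" for b
    using \<sigma> E unfolding coalgebra_valued_def by blast
  have expand: "\<alpha> w = (\<Sum>b\<in>Basis. w (\<xi> b) * \<alpha> (E b))"
    if "linear_on (tangent_space G e) \<alpha>" "w \<in> tangent_space G e" for \<alpha> w
    unfolding E_def
    by (subst fr[OF that(2)], rule linear_on_tangent_sum[OF that(1) E[unfolded E_def]])
  have lin: "linear_on (tangent_space G e) (\<sigma> y)" for y
    using \<sigma> unfolding coalgebra_valued_def dual_space_def by blast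
  have "v (\<lambda>y. \<sigma> y (\<theta> y)) = v (\<lambda>y. \<Sum>b\<in>Basis. \<theta> y (\<xi> b) * \<sigma> y (E b))"
    by (simp add: expand[OF lin \<theta>T, symmetric])
  also have "\<dots> = (\<Sum>b\<in>Basis. v (\<lambda>y. \<theta> y (\<xi> b)) * \<sigma> x (E b) + \<theta> x (\<xi> b) * v (\<lambda>y. \<sigma> y (E b)))"
    by (simp add: tangent_sum[OF M v smooth_fun_mult[OF M \<theta>s \<sigma>s]] tangent_mult[OF v \<theta>s \<sigma>s])
  also have "\<dots> = (\<Sum>b\<in>Basis. \<theta> x (\<xi> b) * diff_along \<sigma> v (E b))
      + (\<Sum>b\<in>Basis. diff_along \<theta> v (\<xi> b) * \<sigma> x (E b))"
    by (simp add: diff_along_def sum.distrib add.commute)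
  also have "\<dots> = diff_along \<sigma> v (\<theta> x) + \<sigma> x (diff_along \<theta> v)"
    using expand[OF dual_space_linear[OF diff_along_coalgebra_valued[OF M \<sigma> v]] \<theta>T]
      expand[OF lin diff_along_algebra_valued[OF M \<theta> v]] by simp
  finally show ?thesis .
qed

section \<open>The coadjoint operator\<close>

lemma module_pointwise_scale:
  "module (\<lambda>(c::real) f x. c * f x)" "module (\<lambda>(c::real) u x a. c * u x a)"
  by unfold_locales (auto simp: fun_eq_iff algebra_simps)

lemma ext_d_add:
  assumes "f \<in> smooth_fun M" "g \<in> smooth_fun M"
  shows "ext_d M (\<lambda>x. f x + g x) = ext_d M f + ext_d M g"
  using assms by (auto simp: ext_d_def fun_eq_iff tangent_add)

lemma ext_d_uminus:
  assumes "f \<in> smooth_fun M"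
  shows "ext_d M (\<lambda>x. - f x) = - ext_d M f"
proof -
  have "v (\<lambda>x. - f x) = - v f" if "v \<in> tangent_space M x" for v x
    using tangent_scale[OF that assms, of "-1"] by simp
  then show ?thesis by (auto simp: ext_d_def fun_eq_iff)
qed

section \<open>Duality and the Euler-Poincare equation in the function classes\<close>

context l2_duality
begin

lemma B_add: "\<lbrakk>\<beta> \<in> B; \<beta>' \<in> B\<rbrakk> \<Longrightarrow> \<beta> + \<beta>' \<in> B"
  and S_add: "\<lbrakk>\<sigma> \<in> S; \<sigma>' \<in> S\<rbrakk> \<Longrightarrow> \<sigma> + \<sigma>' \<in> S"
  and F_add: "\<lbrakk>f \<in> F; f' \<in> F\<rbrakk> \<Longrightarrow> f + f' \<in> F"
  using subspaces module.subspace_add module_pointwise_scale by blast+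

lemma B_diff: "\<lbrakk>\<beta> \<in> B; \<beta>' \<in> B\<rbrakk> \<Longrightarrow> \<beta> - \<beta>' \<in> B"
  and S_diff: "\<lbrakk>\<sigma> \<in> S; \<sigma>' \<in> S\<rbrakk> \<Longrightarrow> \<sigma> - \<sigma>' \<in> S"
  using subspaces module.subspace_diff module_pointwise_scale by blast+

lemma F_uminus: "f \<in> F \<Longrightarrow> - f \<in> F"
  using subspaces module.subspace_neg module_pointwise_scale by blast

lemma X_zero: "0 \<in> X"
  using subspaces module.subspace_0 module_pointwise_scale by blast

lemma X_vector_fields: "u \<in> X \<Longrightarrow> u \<in> vector_fields M"
  using smooth unfolding div_free_fields_def by blast

text \<open>Read off from closure of \<open>X \<times> N\<close> under \<open>aut_bracket\<close>:
  with zero vector fields, the second component is the pointwise bracket alone.\<close>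

lemma lie_bracket_tangent:
  assumes "\<nu> \<in> N" "\<theta> \<in> N"
  shows "lie_bracket G mul e (\<nu> x) (\<theta> x) \<in> tangent_space G e"
proof -
  have "snd (aut_bracket G mul e (0, \<nu>) (0, \<theta>)) \<in> N"
    using lie_algebra[of "(0, \<nu>)" "(0, \<theta>)"] X_zero assms by auto
  then have "lie_bracket G mul e (\<nu> x) (\<theta> x) - diff_along \<theta> 0 + diff_along \<nu> 0 \<in> tangent_space G e"
    using smooth(2) by (auto simp: aut_bracket_def algebra_valued_def)
  moreover have "diff_along \<theta> 0 = 0" "diff_along \<nu> 0 = 0"
    by (auto simp: diff_along_def)
  ultimately show ?thesis by simp
qed

lemma integral_derivative_eq_0:
  assumes M: "smooth_atlas M" and \<mu>: "top_form M \<mu>" and u: "u \<in> X" and f: "f \<in> F"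
  shows "(\<integral>x. u x f \<partial>m) = 0"
proof -
  have "has_divergence M \<mu> u (\<lambda>x. 0)"
    using smooth(1) u unfolding div_free_fields_def by blast
  then have "has_divergence M \<mu> (\<lambda>x a. f x * u x a) (\<lambda>x. f x * 0 + u x f)"
    using has_divergence_scale[OF M \<mu> X_vector_fields[OF u]] smooth(5) f by blast
  then show ?thesis
    using no_boundary_terms[OF f u] by simp
qed

lemma integrable_pairing:
  assumes "\<beta> \<in> B" "\<sigma> \<in> S" "u \<in> X" "\<nu> \<in> N"
  shows "integrable m (\<lambda>x. \<beta> x (u x) + \<sigma> x (\<nu> x))"
  by (rule Bochner_Integration.integrable_add[OF integrable(1)[OF assms(1,3)]
        integrable(2)[OF assms(2,4)]])

lemma l2_pairing_coadjoint:
  assumes M: "smooth_atlas M" and \<mu>: "top_form M \<mu>" and G: "smooth_atlas G"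
    and u: "u \<in> X" and \<nu>: "\<nu> \<in> N" and w: "w \<in> X" and \<theta>: "\<theta> \<in> N"
    and \<beta>: "\<beta> \<in> B" and \<sigma>: "\<sigma> \<in> S"
  shows "l2_pairing m (lie_derivative M u \<beta> + contract_d M \<sigma> \<nu>,
      (\<lambda>x. diff_along \<sigma> (u x)) + (\<lambda>x. ad_star G mul e (\<nu> x) (\<sigma> x))) (w, \<theta>)
    = l2_pairing m (\<beta>, \<sigma>) (aut_bracket G mul e (u, \<nu>) (w, \<theta>))"
    (is "l2_pairing m (?\<beta>, ?\<sigma>) _ = _")
proof -
  obtain w' \<theta>' where br: "aut_bracket G mul e (u, \<nu>) (w, \<theta>) = (w', \<theta>')" by fastforce
  then have wt: "w' \<in> X" "\<theta>' \<in> N"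
    using lie_algebra[of "(u, \<nu>)" "(w, \<theta>)"] u \<nu> w \<theta> by auto
  note uV = X_vector_fields[OF u] and wV = X_vector_fields[OF w]
  have \<beta>': "\<beta> \<in> one_forms M" and \<sigma>': "\<sigma> \<in> coalgebra_valued M G e"
    and \<nu>': "\<nu> \<in> algebra_valued M G e" and \<theta>'': "\<theta> \<in> algebra_valued M G e"
    using smooth \<beta> \<sigma> \<nu> \<theta> by blast+
  have \<theta>T: "\<theta> x \<in> tangent_space G e" for x
    using \<theta>'' unfolding algebra_valued_def by blast
  have lin: "linear_on (tangent_space G e) (\<sigma> x)" for x
    using \<sigma>' unfolding coalgebra_valued_def dual_space_def by blast
  \<comment> \<open>Both pairings are collected in one element of \<open>F\<close>, so a single
    integration by parts suffices.\<close>
  define k where "k = (\<lambda>y. \<beta> y (w y)) + (\<lambda>y. \<sigma> y (\<theta> y))"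
  have k: "k \<in> F" unfolding k_def by (rule F_add[OF operations(2)[OF \<beta> w] operations(3)[OF \<sigma> \<theta>]])
  have "?\<beta> x (w x) + ?\<sigma> x (\<theta> x) - (\<beta> x (w' x) + \<sigma> x (\<theta>' x)) = u x k" for x
  proof -
    note ux = vector_fieldsD(1)[OF uV, of x] and wx = vector_fieldsD(1)[OF wV, of x]
    note jx = vector_fieldsD(1)[OF jacobi_lie_vector_fields[OF M uV wV], of x]
    define lb where "lb = lie_bracket G mul e (\<nu> x) (\<theta> x)"
    have lb: "lb \<in> tangent_space G e"
      unfolding lb_def by (rule lie_bracket_tangent[OF \<nu> \<theta>])
    have d1: "diff_along \<theta> (u x) \<in> tangent_space G e"
      by (rule diff_along_algebra_valued[OF M \<theta>'' ux])
    have d2: "diff_along \<nu> (w x) \<in> tangent_space G e"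
      by (rule diff_along_algebra_valued[OF M \<nu>' wx])
    have "w' x = (\<lambda>f. (-1) * jacobi_lie u w x f)"
      using br by (auto simp: aut_bracket_def fun_eq_iff)
    then have 1: "\<beta> x (w' x) = - \<beta> x (jacobi_lie u w x)"
      using linear_on_scale[OF one_forms_linear[OF \<beta>'] jx, of "-1"] by simp
    have "\<theta>' x = (\<lambda>f. (lb f - diff_along \<theta> (u x) f) + diff_along \<nu> (w x) f)"
      using br by (auto simp: aut_bracket_def fun_eq_iff lb_def)
    then have 2: "\<sigma> x (\<theta>' x) = \<sigma> x lb - \<sigma> x (diff_along \<theta> (u x)) + \<sigma> x (diff_along \<nu> (w x))"
      by (simp add: linear_on_add[OF lin tangent_space_diff[OF lb d1] d2]
          linear_on_tangent_diff[OF lin lb d1])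
    have 3: "?\<beta> x (w x) = u x (\<lambda>y. \<beta> y (w y)) - \<beta> x (jacobi_lie u w x) + \<sigma> x (diff_along \<nu> (w x))"
      using wx by (simp add: lie_derivative(2)[OF M uV \<beta>' wV] contract_d_def)
    have 4: "?\<sigma> x (\<theta> x) = diff_along \<sigma> (u x) (\<theta> x) + \<sigma> x lb"
      using \<theta>T by (simp add: ad_star_def lb_def)
    have "(\<lambda>y. \<beta> y (w y)) \<in> smooth_fun M" "(\<lambda>y. \<sigma> y (\<theta> y)) \<in> smooth_fun M"
      using operations(2)[OF \<beta> w] operations(3)[OF \<sigma> \<theta>] smooth(5) by blast+
    then have 5: "u x k = u x (\<lambda>y. \<beta> y (w y)) + u x (\<lambda>y. \<sigma> y (\<theta> y))"
      unfolding k_def using tangent_add[OF ux] by (simp add: plus_fun_def)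
    show ?thesis
      unfolding 1 2 3 4 5 diff_along_pairing[OF M G ux \<sigma>' \<theta>''] by simp
  qed
  moreover have "?\<beta> \<in> B" "?\<sigma> \<in> S"
    by (rule B_add[OF operations(4)[OF \<beta> u] operations(5)[OF \<sigma> \<nu>]],
        rule S_add[OF operations(6)[OF \<sigma> u] operations(7)[OF \<sigma> \<nu>]])
  \<comment> \<open>Both pairings are between members of the given classes, hence integrable. The
    pointwise identity may therefore be integrated as a difference.\<close>
  ultimately have "l2_pairing m (?\<beta>, ?\<sigma>) (w, \<theta>) - l2_pairing m (\<beta>, \<sigma>) (w', \<theta>') = (\<integral>x. u x k \<partial>m)"
    using Bochner_Integration.integral_diff[OF
        integrable_pairing[of ?\<beta> ?\<sigma> w \<theta>] integrable_pairing[of \<beta> \<sigma> w' \<theta>']] wt w \<theta> \<beta> \<sigma>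
    by (simp only: l2_pairing_def prod.case)
  then show ?thesis
    using integral_derivative_eq_0[OF M \<mu> u k] br by simp
qed

text \<open>\<open>dF \<times> {0}\<close> is an additive subgroup, so membership in it does not
  depend on the representative of a class modulo it.\<close>

lemma ext_d_add_iff:
  fixes \<alpha> \<tau> :: "'m one_form \<times> 'b::monoid_add"
  assumes "\<tau> \<in> ext_d M ` F \<times> {0}"
  shows "\<alpha> + \<tau> \<in> ext_d M ` F \<times> {0} \<longleftrightarrow> \<alpha> \<in> ext_d M ` F \<times> {0}"
proof -
  have add: "\<alpha> + \<beta> \<in> ext_d M ` F" if ab: "\<alpha> \<in> ext_d M ` F" "\<beta> \<in> ext_d M ` F" for \<alpha> \<beta>
  proof -
    obtain f h where fh: "\<alpha> = ext_d M f" "\<beta> = ext_d M h" "f \<in> F" "h \<in> F" using ab by blast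
    then have "\<alpha> + \<beta> = ext_d M (f + h)"
      using ext_d_add[OF subsetD subsetD, OF smooth(5) _ smooth(5)] by (simp add: plus_fun_def)
    then show ?thesis using fh F_add by blast
  qed
  have neg: "- \<alpha> \<in> ext_d M ` F" if a: "\<alpha> \<in> ext_d M ` F" for \<alpha>
  proof -
    obtain f where f: "\<alpha> = ext_d M f" "f \<in> F" using a by blast
    then have "- \<alpha> = ext_d M (- f)"
      using smooth(5) ext_d_uminus[of f M] by (auto simp: fun_Compl_def)
    then show ?thesis using f F_uminus by blast
  qed
  obtain \<tau>1 where \<tau>: "\<tau> = (\<tau>1, 0)" "\<tau>1 \<in> ext_d M ` F" using assms by auto
  obtain \<alpha>1 \<alpha>2 where \<alpha>: "\<alpha> = (\<alpha>1, \<alpha>2)" by fastforce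
  have "\<alpha>1 + \<tau>1 \<in> ext_d M ` F \<longleftrightarrow> \<alpha>1 \<in> ext_d M ` F"
    using add[of \<alpha>1 \<tau>1] add[of "\<alpha>1 + \<tau>1" "- \<tau>1"] neg[of \<tau>1] \<tau>(2) by auto
  then show ?thesis by (simp add: \<alpha> \<tau>)
qed

lemma l2_pairing_diff:
  assumes "\<alpha> \<in> B \<times> S" "\<tau> \<in> B \<times> S" "\<zeta> \<in> X \<times> N"
  shows "l2_pairing m (\<alpha> - \<tau>) \<zeta> = l2_pairing m \<alpha> \<zeta> - l2_pairing m \<tau> \<zeta>"
proof -
  obtain \<beta> \<sigma> where \<alpha>: "\<alpha> = (\<beta>, \<sigma>)" "\<beta> \<in> B" "\<sigma> \<in> S" using assms(1) by auto
  obtain \<beta>' \<sigma>' where \<tau>: "\<tau> = (\<beta>', \<sigma>')" "\<beta>' \<in> B" "\<sigma>' \<in> S" using assms(2) by auto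
  obtain u \<nu> where \<zeta>: "\<zeta> = (u, \<nu>)" "u \<in> X" "\<nu> \<in> N" using assms(3) by auto
  show ?thesis
    using Bochner_Integration.integral_diff[OF integrable_pairing[OF \<alpha>(2,3) \<zeta>(2,3)]
        integrable_pairing[OF \<tau>(2,3) \<zeta>(2,3)]]
    by (simp add: l2_pairing_def \<alpha>(1) \<tau>(1) \<zeta>(1) algebra_simps)
qed

text \<open>The explicit pair \<open>\<tau>0\<close> shows that the description chosen by
  \<open>SOME\<close> is satisfiable. The chosen \<open>\<tau>\<close> has the same pairing with
  \<open>X \<times> N\<close>, so nondegeneracy puts \<open>\<tau> - \<tau>0\<close> into
  \<open>dF \<times> {0}\<close>, and either may be used in the equation.\<close>

lemma euler_poincare_aut_vol_iff:
  assumes M: "smooth_atlas M" and \<mu>: "top_form M \<mu>" and G: "smooth_atlas G"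
    and u: "u \<in> X" and \<nu>: "\<nu> \<in> N" and \<beta>: "\<beta> \<in> B" and \<sigma>: "\<sigma> \<in> S"
  shows "euler_poincare_aut_vol M m G mul e X N B S F (u, \<nu>) (\<beta>, \<sigma>) (\<beta>\<^sub>t, \<sigma>\<^sub>t) \<longleftrightarrow>
    \<beta>\<^sub>t + lie_derivative M u \<beta> + contract_d M \<sigma> \<nu> \<in> ext_d M ` F \<and>
    \<sigma>\<^sub>t + (\<lambda>x. diff_along \<sigma> (u x)) + (\<lambda>x. ad_star G mul e (\<nu> x) (\<sigma> x)) = 0"
proof -
  define \<tau>0 where "\<tau>0 = (lie_derivative M u \<beta> + contract_d M \<sigma> \<nu>,
      (\<lambda>x. diff_along \<sigma> (u x)) + (\<lambda>x. ad_star G mul e (\<nu> x) (\<sigma> x)))"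
  define P where "P \<tau> \<longleftrightarrow> \<tau> \<in> B \<times> S \<and> (\<forall>\<zeta>\<in>X \<times> N. l2_pairing m \<tau> \<zeta>
      = l2_pairing m (\<beta>, \<sigma>) (aut_bracket G mul e (u, \<nu>) \<zeta>))" for \<tau>
  define \<tau> where "\<tau> = coadjoint (X \<times> N) (B \<times> S) (l2_pairing m) (aut_bracket G mul e) (u, \<nu>) (\<beta>, \<sigma>)"
  have \<tau>0: "P \<tau>0"
    using l2_pairing_coadjoint[OF M \<mu> G u \<nu> _ _ \<beta> \<sigma>] B_add S_add operations \<beta> \<sigma> u \<nu>
    by (auto simp: P_def \<tau>0_def)
  have "\<tau> = (SOME \<tau>. P \<tau>)"
    unfolding \<tau>_def coadjoint_def P_def ..
  then have \<tau>: "P \<tau>"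
    using someI[of P, OF \<tau>0] by simp
  have "\<tau> - \<tau>0 \<in> B \<times> S"
    using \<tau> \<tau>0 B_diff S_diff unfolding P_def mem_Times_iff fst_diff snd_diff by blast
  moreover have "l2_pairing m (\<tau> - \<tau>0) \<zeta> = 0" if "\<zeta> \<in> X \<times> N" for \<zeta>
  proof -
    have "P \<tau>' \<Longrightarrow> l2_pairing m \<tau>' \<zeta> = l2_pairing m (\<beta>, \<sigma>) (aut_bracket G mul e (u, \<nu>) \<zeta>)" for \<tau>'
      using that unfolding P_def by blast
    moreover have "\<tau> \<in> B \<times> S" "\<tau>0 \<in> B \<times> S"
      using \<tau> \<tau>0 unfolding P_def by blast+
    ultimately show ?thesis
      using \<tau> \<tau>0 l2_pairing_diff[OF _ _ that] by simp
  qed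
  ultimately have "\<tau> - \<tau>0 \<in> ext_d M ` F \<times> {0}"
    by (rule nondegenerate)
  from ext_d_add_iff[OF this, of "(\<beta>\<^sub>t, \<sigma>\<^sub>t) + \<tau>0"]
  have "(\<beta>\<^sub>t, \<sigma>\<^sub>t) + \<tau> \<in> ext_d M ` F \<times> {0} \<longleftrightarrow> (\<beta>\<^sub>t, \<sigma>\<^sub>t) + \<tau>0 \<in> ext_d M ` F \<times> {0}"
    by (simp add: algebra_simps)
  then show ?thesis
    unfolding euler_poincare_aut_vol_def euler_poincare_def \<tau>_def[symmetric]
    by (simp add: \<tau>0_def add.assoc)
qed

text \<open>Passes to the sign convention of a pressure; \<open>F\<close> is closed under
  negation.\<close>

lemma ext_d_image_uminus: "\<alpha> \<in> ext_d M ` F \<longleftrightarrow> (\<exists>p\<in>F. \<alpha> = - ext_d M p)"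
proof -
  have "- ext_d M p = ext_d M (- p)" if "p \<in> F" for p
    using smooth(5) that ext_d_uminus[of p M] by (auto simp: fun_Compl_def)
  then have "(\<exists>p\<in>F. \<alpha> = - ext_d M p) \<longleftrightarrow> (\<exists>p\<in>F. \<alpha> = ext_d M (- p))" by auto
  also have "\<dots> \<longleftrightarrow> \<alpha> \<in> ext_d M ` F"
  proof
    assume "\<alpha> \<in> ext_d M ` F"
    then obtain p where "p \<in> F" "\<alpha> = ext_d M p" by blast
    then show "\<exists>p\<in>F. \<alpha> = ext_d M (- p)" using F_uminus[of p] by (intro bexI[of _ "- p"]) simp_all
  qed (use F_uminus in blast)
  finally show ?thesis ..
qed

end

theorem proposition4p3:
  fixes M :: "('m::{second_countable_topology,t2_space}, 'e::euclidean_space) atlas"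
    and g :: "'m \<Rightarrow> 'm tangent \<Rightarrow> 'm tangent \<Rightarrow> real"
    and \<mu> :: "'m \<Rightarrow> ('e \<Rightarrow> 'm tangent) \<Rightarrow> real"
    and m :: "'m measure"
    and G :: "('g::{second_countable_topology,t2_space}, 'f::euclidean_space) atlas"
    and mul :: "'g \<Rightarrow> 'g \<Rightarrow> 'g" and e :: 'g and inve :: "'g \<Rightarrow> 'g"
    and X :: "'m vector_field set" and N :: "('m \<Rightarrow> 'g tangent) set"
    and B :: "'m one_form set" and S :: "('m \<Rightarrow> 'g tangent \<Rightarrow> real) set"
    and F :: "('m \<Rightarrow> real) set"
    and l :: "'m vector_field \<times> ('m \<Rightarrow> 'g tangent) \<Rightarrow> real"
    and T :: "real set"
    and u :: "real \<Rightarrow> 'm vector_field" and \<nu> :: "real \<Rightarrow> 'm \<Rightarrow> 'g tangent"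
    and dl_u :: "real \<Rightarrow> 'm one_form" and dl_\<nu> :: "real \<Rightarrow> 'm \<Rightarrow> 'g tangent \<Rightarrow> real"
  assumes "smooth_atlas M" and "riemannian_metric M g" and "riemannian_volume_form M g \<mu>"
    and "volume_measure M \<mu> m"
    and "lie_group G mul e inve"
    and "l2_duality M \<mu> m G mul e X N B S F"
    and "open T" and "is_interval T"
    and "\<And>t. t \<in> T \<Longrightarrow> (u t, \<nu> t) \<in> X \<times> N"
    and "\<And>t. t \<in> T \<Longrightarrow>
      functional_derivative m (X \<times> N) (B \<times> S) l (u t, \<nu> t) (dl_u t, dl_\<nu> t)"
    and "\<And>t x v. t \<in> T \<Longrightarrow> (\<lambda>s. dl_u s x v) differentiable (at t)"
    and "\<And>t x \<xi>. t \<in> T \<Longrightarrow> (\<lambda>s. dl_\<nu> s x \<xi>) differentiable (at t)"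
    and "\<And>t. t \<in> T \<Longrightarrow> (time_deriv dl_u t, time_deriv dl_\<nu> t) \<in> B \<times> S"
  shows "(\<forall>t\<in>T. euler_poincare_aut_vol M m G mul e X N B S F
            (u t, \<nu> t) (dl_u t, dl_\<nu> t) (time_deriv dl_u t, time_deriv dl_\<nu> t)) \<longleftrightarrow>
         (\<exists>p :: real \<Rightarrow> 'm \<Rightarrow> real. \<forall>t\<in>T. p t \<in> F \<and>
            time_deriv dl_u t + lie_derivative M (u t) (dl_u t) + contract_d M (dl_\<nu> t) (\<nu> t)
              = - ext_d M (p t) \<and>
            has_divergence M \<mu> (u t) (\<lambda>x. 0) \<and>
            time_deriv dl_\<nu> t + (\<lambda>x. diff_along (dl_\<nu> t) (u t x))
              + (\<lambda>x. ad_star G mul e (\<nu> t x) (dl_\<nu> t x)) = 0)"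
proof -
  interpret l2_duality M \<mu> m G mul e X N B S F by fact
  have \<mu>: "top_form M \<mu>" and G: "smooth_atlas G"
    using assms(3,5) by (simp_all add: riemannian_volume_form_def lie_group_def)
  define Q where "Q t p \<longleftrightarrow> p \<in> F \<and>
      time_deriv dl_u t + lie_derivative M (u t) (dl_u t) + contract_d M (dl_\<nu> t) (\<nu> t)
        = - ext_d M p \<and>
      has_divergence M \<mu> (u t) (\<lambda>x. 0) \<and>
      time_deriv dl_\<nu> t + (\<lambda>x. diff_along (dl_\<nu> t) (u t x))
        + (\<lambda>x. ad_star G mul e (\<nu> t x) (dl_\<nu> t x)) = 0" for t p
  have "euler_poincare_aut_vol M m G mul e X N B S F
      (u t, \<nu> t) (dl_u t, dl_\<nu> t) (time_deriv dl_u t, time_deriv dl_\<nu> t) \<longleftrightarrow> (\<exists>p. Q t p)"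
    if t: "t \<in> T" for t
  proof -
    have u: "u t \<in> X" and \<nu>: "\<nu> t \<in> N" using assms(9)[OF t] by auto
    have dl: "dl_u t \<in> B" "dl_\<nu> t \<in> S"
      using assms(10)[OF t] by (auto simp: functional_derivative_def)
    \<comment> \<open>Incompressibility is a constraint on the Lie algebra and not an equation of
      motion: it comes from \<open>u t \<in> X\<close>.\<close>
    have "has_divergence M \<mu> (u t) (\<lambda>x. 0)"
      using smooth(1) u unfolding div_free_fields_def by blast
    then show ?thesis
      unfolding euler_poincare_aut_vol_iff[OF assms(1) \<mu> G u \<nu> dl] ext_d_image_uminus Q_def
      by blast
  qed
  \<comment> \<open>A pressure is chosen separately at each time by the axiom of choice; nothing
    relates the pressures at different times.\<close>
  then show ?thesis
    unfolding Q_def[symmetric] by (simp only: bchoice_iff[of T Q, symmetric] cong: ball_cong)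
qed

end
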